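(* Let $n\ge 1$ and let $Q(z)=(z-a_1)(z-a_2)\cdots(z-a_n)\in\mathbb{C}[z]$ be a monic strong uniqueness polynomial with pairwise distinct roots $a_1,\dots,a_n$, and put $S=\{a_1,\dots,a_n\}$. Let $m_1$ and $m_2$ denote, respectively, the number of distinct simple zeros and the number of distinct multiple zeros of the polynomial $Q(z)-Q(0)$, and let $k$ denote the number of distinct zeros of $Q'(z)$. Suppose that $n>\max\{2k+2,\, m_1+m_2\}$, $m_1+m_2>2$ and $k\ge 2$. Let $\mathfrak{f}$ be a transcendental entire function with hyper-order $\rho_2(\mathfrak{f})<1$, and let $c\in\mathbb{C}\setminus\{0\}$. If $\mathfrak{f}(z)$ and $\mathfrak{f}(z+c)$ share the set $S$ with weight $2$, i.e. $E_{\mathfrak{f}(z)}(S,2)=E_{\mathfrak{f}(z+c)}(S,2)$, then $\mathfrak{f}(z)\equiv\mathfrak{f}(z+c)$.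
   Context: A non-constant monic polynomial $P(z)$ is called a strong uniqueness polynomial (for meromorphic functions) if, whenever $\mathfrak{f},\mathfrak{g}$ are non-constant meromorphic functions on $\mathbb{C}$ and $\alpha$ is a non-zero constant with $P(\mathfrak{f})\equiv\alpha P(\mathfrak{g})$, it follows that $\mathfrak{f}\equiv\mathfrak{g}$. The hyper-order of a meromorphic function $\mathfrak{f}$ is $\rho_2(\mathfrak{f})=\limsup_{r\to\infty}\frac{\log\log T(r,\mathfrak{f})}{\log r}$, where $T(r,\mathfrak{f})$ is the Nevanlinna characteristic function. Weighted sharing: for a non-negative integer $l$ (or $\infty$) and $a\in\mathbb{C}$, $E_l(a;\mathfrak{f})$ denotes the set of $a$-points of $\mathfrak{f}$, where an $a$-point of multiplicity $m$ is counted $m$ times if $m\le l$ and $l+1$ times if $m>l$. For a set $S\subset\mathbb{C}$, $E_{\mathfrak{f}}(S,l)=\bigcup_{a\in S}E_l(a;\mathfrak{f})$ (as a multiset of points), and $\mathfrak{f}$, $\mathfrak{g}$ share $S$ with weight $l$ if $E_{\mathfrak{f}}(S,l)=E_{\mathfrak{g}}(S,l)$. *)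

theory Defs
  imports "HOL-Complex_Analysis.Complex_Analysis" "HOL-Computational_Algebra.Polynomial"
begin

text \<open>Strong uniqueness polynomial (for meromorphic functions on the whole plane).
  Identities between meromorphic functions are understood up to a discrete set
  (Isabelle's meromorphic functions carry arbitrary values at poles).\<close>
definition nonconstant_mero :: "(complex \<Rightarrow> complex) \<Rightarrow> bool" where
  "nonconstant_mero f \<longleftrightarrow> f meromorphic_on UNIV \<and> \<not> (\<exists>c. \<forall>\<^sub>\<approx>z. f z = c)"

definition strong_uniqueness_poly :: "complex poly \<Rightarrow> bool" where
  "strong_uniqueness_poly P \<longleftrightarrow>
     degree P \<ge> 1 \<and> lead_coeff P = 1 \<and>
     (\<forall>f g (\<alpha>::complex). nonconstant_mero f \<longrightarrow> nonconstant_mero g \<longrightarrow> \<alpha> \<noteq> 0 \<longrightarrow>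
        (\<forall>\<^sub>\<approx>z. poly P (f z) = \<alpha> * poly P (g z)) \<longrightarrow> (\<forall>\<^sub>\<approx>z. f z = g z))"

definition lnplus :: "real \<Rightarrow> real" where
  "lnplus x = (if x \<le> 1 then 0 else ln x)"

text \<open>Nevanlinna characteristic of an entire function (no poles, so T = m).\<close>
definition nev_T_entire :: "(complex \<Rightarrow> complex) \<Rightarrow> real \<Rightarrow> real" where
  "nev_T_entire f r = integral {0..2*pi} (\<lambda>\<theta>. lnplus (cmod (f (of_real r * cis \<theta>)))) / (2*pi)"

definition hyper_order_entire :: "(complex \<Rightarrow> complex) \<Rightarrow> ereal" where
  "hyper_order_entire f =
     Limsup at_top (\<lambda>r::real. ereal (ln (ln (nev_T_entire f r)) / ln r))"

definition transcendental_entire :: "(complex \<Rightarrow> complex) \<Rightarrow> bool" where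
  "transcendental_entire f \<longleftrightarrow> f holomorphic_on UNIV \<and> \<not> (\<exists>p. \<forall>z. f z = poly p z)"

text \<open>Counting function of E_f(S,l) (multiset of points): an a-point (a in S) of
  multiplicity m is counted min m (l+1) times; contributions of distinct a are added.\<close>
definition E_weighted :: "(complex \<Rightarrow> complex) \<Rightarrow> complex set \<Rightarrow> nat \<Rightarrow> complex \<Rightarrow> nat" where
  "E_weighted f S l z = (\<Sum>a\<in>S. if f z = a then min (nat (zorder (\<lambda>w. f w - a) z)) (l + 1) else 0)"

definition share_set_weight :: "(complex \<Rightarrow> complex) \<Rightarrow> (complex \<Rightarrow> complex) \<Rightarrow> complex set \<Rightarrow> nat \<Rightarrow> bool" where
  "share_set_weight f g S l \<longleftrightarrow> (\<forall>z. E_weighted f S l z = E_weighted g S l z)"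

end

theory Submission
  imports Defs "HOL-Computational_Algebra.Fundamental_Theorem_Algebra"
begin

text \<open>
  Put \<open>g(z) = f(z+c)\<close>, \<open>F = Q(f)\<close>, \<open>G = Q(g)\<close>, let \<open>D\<close> be the monic polynomial whose simple zeros are
  the zeros of \<open>Q'\<close>, and let \<open>H = (F''/F' - 2F'/F) - (G''/G' - 2G'/G)\<close>.

  If \<open>H\<close> vanishes identically, integrating twice gives \<open>1/F = A/G + B\<close> with \<open>A \<noteq> 0\<close>. If \<open>B \<noteq> 0\<close>, then
  \<open>Q(f)\<close> omits \<open>1/B\<close>, so by Picard \<open>Q - 1/B\<close> has only one zero, contradicting \<open>k \<ge> 2\<close>; hence \<open>B = 0\<close>
  and strong uniqueness gives \<open>f = g\<close>.

  Otherwise \<open>W = H\<^sup>2 (f' D(f))\<^sup>2 (g' D(g))\<^sup>2 / (F G)\<close> is entire: sharing with weight 2 means that at a common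
  zero the orders of \<open>F\<close> and \<open>G\<close> are both 1 (and \<open>H\<close> vanishes), both 2 (and \<open>H\<close> is regular) or both at
  least 3. Since \<open>n > 2k + 2\<close>, \<open>|W| (1 + |f|) (1 + |g|)\<close> is bounded by a power of the logarithmic
  derivatives involved. Jensen's inequality for \<open>W\<close>, on circles chosen away from the zeros, therefore bounds
  \<open>T(r,f) + T(r,g)\<close> by a multiple of \<open>log log M\<close> at a comparable radius. Starting from the
  bound \<open>log log M(r) = O(r)\<close> provided by the hyper-order, two applications make \<open>f\<close> a polynomial.
\<close>

section \<open>Poisson--Jensen inequality\<close>

text \<open>The square in W is dictated by common simple zeros: F G vanishes there to order 2 while
  a simple zero of H supplies only order 1. The price is a numerator with (f')^2 D(f)^2, and n > 2k
  + 2 is what absorbs it: (w - a) D(w)^2 and w (w - a) D(w)^2 have degree at most 2k + 2, so their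
  quotients by Q split into partial fractions, which become the functions f'/(f - a). Taking D with
  simple zeros keeps its degree at k while it still cancels the poles of F''/F' at the zeros of
  Q'(f).

  Each estimate uses one explicitly chosen circle, instead of asymptotic inequalities outside an
  exceptional set of radii. Losing constant factors in the radius is harmless, because a bound exp
  \<mu> on a large disc turns into a power of \<mu> on a smaller one: the two passes lead from
  exp(exp(O(r))) to exp(O(r)) and then to a power of r. The starting class exp(exp(O(r))) is
  invariant under translation, so f(z + c) enters with the same kind of bound as f.\<close>

lemma finite_zeros_compact:
  fixes h :: "complex \<Rightarrow> complex"
  assumes "h holomorphic_on UNIV" "h w0 \<noteq> 0" "compact K"
  shows "finite {z\<in>K. h z = 0}"
proof (cases "h constant_on UNIV")
  case True
  then have "{z\<in>K. h z = 0} = {}" using assms(2) by (auto simp: constant_on_def)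
  then show ?thesis by (metis finite.emptyI)
next
  case False
  then show ?thesis using holomorphic_compact_finite_zeros[OF assms(1), of K] assms(3) by auto
qed

text \<open>Zeros are kept in a list so that multiplicity is recorded by repetition. The induction
  runs on the number of distinct zeros in \<open>K\<close>; dividing out the full order at one of
  them lowers it strictly.\<close>

lemma entire_zero_factorization:
  fixes h :: "complex \<Rightarrow> complex"
  assumes "h holomorphic_on UNIV" "h w0 \<noteq> 0" "compact K"
  obtains zs h1 where "h1 holomorphic_on UNIV" "\<And>z. h z = (\<Prod>x\<leftarrow>zs. z - x) * h1 z"
    "\<And>z. z \<in> K \<Longrightarrow> h1 z \<noteq> 0" "set zs \<subseteq> K"
proof -
  have "\<exists>zs h1. h1 holomorphic_on UNIV \<and> (\<forall>z. h z = (\<Prod>x\<leftarrow>zs. z - x) * h1 z) \<and>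
          (\<forall>z\<in>K. h1 z \<noteq> 0) \<and> set zs \<subseteq> K"
    using assms
  proof (induction "card {z\<in>K. h z = 0}" arbitrary: h rule: less_induct)
    case less
    have fin: "finite {z\<in>K. h z = 0}" by (rule finite_zeros_compact[OF less.prems])
    show ?case
    proof (cases "{z\<in>K. h z = 0} = {}")
      case True
      then show ?thesis using less.prems
        by (intro exI[of _ "[]"] exI[of _ h]) auto
    next
      case False
      then obtain z0 where z0: "z0 \<in> K" "h z0 = 0" by auto
      define p where "p = nat (zorder h z0)"
      define g where "g = zor_poly h z0"
      have "(\<exists>r. r>0 \<and> cball z0 r \<subseteq> UNIV \<and> g holomorphic_on cball z0 r
          \<and> (\<forall>w\<in>cball z0 r. h w  = g w * (w-z0) ^ p \<and> g w \<noteq>0))"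
        using zorder_exist_zero[of h UNIV z0] less.prems(1,2) unfolding g_def p_def by auto
      then obtain r where r: "r > 0" "g holomorphic_on cball z0 r"
         "\<And>w. w\<in>cball z0 r \<Longrightarrow> h w  = g w * (w-z0) ^ p \<and> g w \<noteq> 0" by blast
      \<comment> \<open>The quotient, with the value of the local cofactor put in at
        \<open>z0\<close>. It agrees with \<open>g\<close> on a ball and with
        \<open>h z / (z - z0) ^ p\<close> off \<open>z0\<close>, and these two open sets cover the
        plane.\<close>
      define h1 where "h1 = (\<lambda>z. if z = z0 then g z0 else h z / (z - z0) ^ p)"
      have e1: "h1 w = g w" if "w \<in> ball z0 r" for w
        using r(3)[of w] that by (auto simp: h1_def)
      have "h1 holomorphic_on ball z0 r"
        using e1 r(2) holomorphic_on_subset[OF r(2) ball_subset_cball] holomorphic_cong by metis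
      moreover have "h1 holomorphic_on (UNIV - {z0})"
      proof (rule holomorphic_transform)
        show "(\<lambda>z. h z / (z - z0) ^ p) holomorphic_on UNIV - {z0}"
          by (intro holomorphic_intros holomorphic_on_subset[OF less.prems(1)]) auto
      qed (auto simp: h1_def)
      ultimately have "h1 holomorphic_on (ball z0 r \<union> (UNIV - {z0}))"
        by (intro holomorphic_on_Un) auto
      moreover have "ball z0 r \<union> (UNIV - {z0}) = UNIV" using r(1) by auto
      ultimately have h1: "h1 holomorphic_on UNIV" by simp
      have p0: "p > 0"
        using r(3)[of z0] r(1) z0 by (cases p) auto
      have eq: "h z = (z - z0) ^ p * h1 z" for z
        using z0 p0 by (auto simp: h1_def)
      have h1z0: "h1 z0 \<noteq> 0" using r(3)[of z0] r(1) by (auto simp: h1_def)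
      have "{z\<in>K. h1 z = 0} \<subset> {z\<in>K. h z = 0}"
        using z0 h1z0 eq by auto
      then have "card {z\<in>K. h1 z = 0} < card {z\<in>K. h z = 0}"
        by (rule psubset_card_mono[OF fin])
      moreover have "h1 w0 \<noteq> 0" using less.prems(2) eq by auto
      ultimately obtain zs h2 where 2: "h2 holomorphic_on UNIV" "\<And>z. h1 z = (\<Prod>x\<leftarrow>zs. z - x) * h2 z"
         "\<forall>z\<in>K. h2 z \<noteq> 0" "set zs \<subseteq> K"
        using less.hyps[of h1] h1 less.prems(3) by blast
      show ?thesis
        by (rule exI[of _ "replicate p z0 @ zs"], rule exI[of _ h2])
           (use 2 eq z0 in \<open>auto simp: map_replicate_const\<close>)
    qed
  qed
  then show ?thesis using that by blast
qed

lemma Poisson_formula_holomorphic: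
  assumes hol: "u holomorphic_on cball 0 r" and z: "cmod z < r"
  shows "((\<lambda>t. of_real ((r\<^sup>2 - (cmod z)\<^sup>2) / (cmod (of_real r * cis t - z))\<^sup>2) * u (of_real r * cis t))
            has_integral (2 * of_real pi * u z)) {0..2*pi}"
proof -
  have r: "r > 0" using z norm_ge_zero[of z] by linarith
  \<comment> \<open>The factor multiplying \<open>u\<close> is holomorphic on the closed disc and
    equals 1 at \<open>z\<close>; on the circle it turns the Cauchy kernel w/(w - z) into the
    Poisson kernel. Cauchy's formula for \<open>k\<close> is therefore the claim.\<close>
  define k where "k = (\<lambda>w. u w * of_real (r\<^sup>2 - (cmod z)\<^sup>2) / (of_real (r\<^sup>2) - cnj z * w))"
  have nz: "of_real (r\<^sup>2) - cnj z * w \<noteq> 0" if "w \<in> cball 0 r" for w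
  proof
    assume "of_real (r\<^sup>2) - cnj z * w = 0"
    then have "cmod (of_real (r\<^sup>2)) = cmod (cnj z * w)" by (metis eq_iff_diff_eq_0)
    then have "r * r = cmod z * cmod w" by (simp add: norm_mult power2_eq_square)
    moreover have "cmod z * cmod w \<le> cmod z * r" using that by (intro mult_left_mono) auto
    moreover have "cmod z * r < r * r" using z r by simp
    ultimately show False by linarith
  qed
  have "k holomorphic_on cball 0 r"
    unfolding k_def by (intro holomorphic_intros hol nz)
  from Cauchy_integral_circlepath_simple[OF this, of z] z
  have "((\<lambda>w. k w / (w - z)) has_contour_integral (2 * of_real pi * \<i> * k z)) (part_circlepath 0 r 0 (2*pi))"
    by (simp add: circlepath_def)
  then have "((\<lambda>t. k (0 + r * cis t) / (0 + r * cis t - z) * r * \<i> * cis t) has_integral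
     (2 * of_real pi * \<i> * k z)) {0..2*pi}"
    by (subst (asm) has_contour_integral_part_circlepath_iff) auto
  note int1 = this
  have "k z = u z"
  proof -
    have "of_real (r\<^sup>2) - cnj z * z = of_real (r\<^sup>2 - (cmod z)\<^sup>2)"
      by (metis complex_norm_square mult.commute of_real_diff)
    moreover have "of_real (r\<^sup>2) - cnj z * z \<noteq> 0" using nz[of z] z by auto
    ultimately show ?thesis unfolding k_def by simp
  qed
  with int1 have int2: "((\<lambda>t. k (0 + r * cis t) / (0 + r * cis t - z) * r * \<i> * cis t) has_integral
     (2 * of_real pi * \<i> * u z)) {0..2*pi}" by simp
  have "((\<lambda>t. - \<i> * (k (0 + r * cis t) / (0 + r * cis t - z) * r * \<i> * cis t)) has_integral
     - \<i> * (2 * of_real pi * \<i> * u z)) {0..2*pi}"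
    by (rule has_integral_mult_right[OF int2])
  moreover have "- \<i> * (k (0 + r * cis t) / (0 + r * cis t - z) * r * \<i> * cis t) =
     of_real ((r\<^sup>2 - (cmod z)\<^sup>2) / (cmod (of_real r * cis t - z))\<^sup>2) * u (of_real r * cis t)" for t
  proof -
    define w where "w = of_real r * cis t"
    have w: "cmod w = r" using r by (simp add: w_def norm_mult)
    have "of_real (r\<^sup>2) = w * cnj w" using w by (metis complex_norm_square)
    then have e: "of_real (r\<^sup>2) - cnj z * w = w * cnj (w - z)" by (simp add: algebra_simps)
    have e2: "of_real ((cmod (w - z))\<^sup>2) = (w - z) * cnj (w - z)" by (metis complex_norm_square)
    have "w \<noteq> 0" "w - z \<noteq> 0" "cnj (w - z) \<noteq> 0" using w r z by auto
    then have "k w / (w - z) * w = of_real (r\<^sup>2 - (cmod z)\<^sup>2) / of_real ((cmod (w - z))\<^sup>2) * u w"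
      unfolding k_def e e2 by (simp add: divide_simps del: complex_cnj_diff)
    moreover have "- \<i> * (k (0 + r * cis t) / (0 + r * cis t - z) * r * \<i> * cis t) = k w / (w - z) * w"
      by (simp add: w_def field_simps)
    ultimately show ?thesis by (simp add: w_def)
  qed
  ultimately show ?thesis by (simp add: mult.assoc mult.left_commute)
qed

lemma prod_list_norm: "cmod (\<Prod>x\<leftarrow>xs. k x) = (\<Prod>x\<leftarrow>xs. cmod (k x))"
  by (induction xs) (auto simp: norm_mult)

lemma prod_list_map_mono:
  fixes k l :: "'a \<Rightarrow> real"
  assumes "\<And>x. x \<in> set xs \<Longrightarrow> 0 \<le> k x \<and> k x \<le> l x"
  shows "0 \<le> (\<Prod>x\<leftarrow>xs. k x) \<and> (\<Prod>x\<leftarrow>xs. k x) \<le> (\<Prod>x\<leftarrow>xs. l x)"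
  using assms by (induction xs) (auto intro!: mult_mono mult_nonneg_nonneg, force)

lemma holomorphic_on_prod_list [holomorphic_intros]:
  assumes "\<And>x. x \<in> set xs \<Longrightarrow> k x holomorphic_on A"
  shows "(\<lambda>z. \<Prod>x\<leftarrow>xs. k x z) holomorphic_on A"
  using assms by (induction xs) (auto intro!: holomorphic_intros)

text \<open>For |x| < r, replacing a factor w - x by (r^2 - cnj x * w)/r moves the zero out of the
  disc and can only raise the modulus inside; by the companion equality it keeps the modulus on the
  circle.\<close>

lemma Blaschke_factor_le:
  assumes "cmod x \<le> r" "cmod w \<le> r" "r > 0"
  shows "cmod (w - x) \<le> cmod ((of_real (r\<^sup>2) - cnj x * w) / of_real r)"
proof -
  have e: "(cmod (of_real (r\<^sup>2) - cnj x * w))\<^sup>2 - r\<^sup>2 * (cmod (w - x))\<^sup>2 =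
     (r\<^sup>2 - (cmod x)\<^sup>2) * (r\<^sup>2 - (cmod w)\<^sup>2)"
    unfolding cmod_power2 by (simp add: power2_eq_square algebra_simps)
  have "(cmod x)\<^sup>2 \<le> r\<^sup>2" "(cmod w)\<^sup>2 \<le> r\<^sup>2" using assms by (auto intro: power_mono)
  then have "0 \<le> (r\<^sup>2 - (cmod x)\<^sup>2) * (r\<^sup>2 - (cmod w)\<^sup>2)" by simp
  then have "(r * cmod (w - x))\<^sup>2 \<le> (cmod (of_real (r\<^sup>2) - cnj x * w))\<^sup>2"
    using e by (simp add: power_mult_distrib)
  then have "r * cmod (w - x) \<le> cmod (of_real (r\<^sup>2) - cnj x * w)"
    by (rule power2_le_imp_le) auto
  then show ?thesis using assms by (simp add: norm_divide field_simps)
qed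

lemma Blaschke_factor_eq:
  assumes "cmod w = r" "r > 0"
  shows "cmod (w - x) = cmod ((of_real (r\<^sup>2) - cnj x * w) / of_real r)"
proof -
  have "of_real (r\<^sup>2) = w * cnj w" using assms by (metis complex_norm_square)
  then have e: "of_real (r\<^sup>2) - cnj x * w = w * cnj (w - x)" by (simp add: algebra_simps)
  show ?thesis unfolding e norm_divide norm_mult complex_mod_cnj using assms by auto
qed

text \<open>Exchanging all zero factors of \<open>W\<close> for their Blaschke counterparts gives a
  zero-free \<open>V\<close> with |V| = |W| on the circle and |V| >= |W| inside. Then ln |V| is
  harmonic and satisfies Poisson's formula; only the comparison at \<open>z\<close> loses
  something.\<close>

lemma Poisson_Jensen_inequality:
  assumes hol: "W holomorphic_on UNIV" and bd: "\<And>w. cmod w = r \<Longrightarrow> W w \<noteq> 0"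
    and z: "cmod z < r" and Wz: "W z \<noteq> 0"
  shows "2 * pi * ln (cmod (W z)) \<le>
     integral {0..2*pi} (\<lambda>t. (r\<^sup>2 - (cmod z)\<^sup>2) / (cmod (of_real r * cis t - z))\<^sup>2 * ln (cmod (W (of_real r * cis t))))"
proof -
  have r: "r > 0" using z norm_ge_zero[of z] by linarith
  obtain zs h1 where h1: "h1 holomorphic_on UNIV" and eq: "\<And>z. W z = (\<Prod>x\<leftarrow>zs. z - x) * h1 z"
    and nz: "\<And>z. z \<in> cball 0 r \<Longrightarrow> h1 z \<noteq> 0" and zs: "set zs \<subseteq> cball 0 r"
    by (rule entire_zero_factorization[OF hol Wz compact_cball[of 0 r]]) blast
  have zs': "cmod x < r" if "x \<in> set zs" for x
  proof -
    have "W x = 0" unfolding eq using that by (induction zs) auto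
    then show ?thesis using bd[of x] zs that by force
  qed
  define V where "V = (\<lambda>w. (\<Prod>x\<leftarrow>zs. (of_real (r\<^sup>2) - cnj x * w) / of_real r) * h1 w)"
  have holV: "V holomorphic_on UNIV"
    unfolding V_def using r by (intro holomorphic_intros h1) auto
  have Vnz: "V w \<noteq> 0" if "w \<in> cball 0 r" for w
  proof -
    have "of_real (r\<^sup>2) - cnj x * w \<noteq> 0" if x: "x \<in> set zs" for x
    proof
      assume "of_real (r\<^sup>2) - cnj x * w = 0"
      then have "cmod (of_real (r\<^sup>2)) = cmod (cnj x * w)" by (metis eq_iff_diff_eq_0)
      then have "r * r = cmod x * cmod w" by (simp add: norm_mult power2_eq_square)
      moreover have "cmod x * cmod w \<le> cmod x * r" using \<open>w \<in> cball 0 r\<close> by (intro mult_left_mono) auto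
      moreover have "cmod x * r < r * r" using zs'[OF x] r by simp
      ultimately show False by linarith
    qed
    then show ?thesis using nz[OF that] r by (auto simp: V_def prod_list_zero_iff)
  qed
  have le: "cmod (W z) \<le> cmod (V z)"
    unfolding eq V_def norm_mult prod_list_norm
    by (intro mult_right_mono prod_list_map_mono[THEN conjunct2] conjI Blaschke_factor_le)
       (use zs' z r in \<open>auto intro: less_imp_le simp del: of_real_power\<close>)
  have eqs: "cmod (W w) = cmod (V w)" if "cmod w = r" for w
    unfolding eq V_def norm_mult prod_list_norm
    using Blaschke_factor_eq[OF that r] by simp
  \<comment> \<open>The logarithm of \<open>V\<close> must be holomorphic up to the boundary, so a
    slightly larger zero-free disc is needed. Compactness yields a uniform \<open>e\<close>; a point
    of the outer ring is compared with its radial projection \<open>x\<close> onto the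
    circle.\<close>
  have "open {w. V w \<noteq> 0}"
    using holV by (intro open_Collect_neq holomorphic_on_imp_continuous_on) auto
  moreover have "cball 0 r \<subseteq> {w. V w \<noteq> 0}" using Vnz by auto
  ultimately obtain e where e: "e > 0" "(\<Union>x\<in>cball 0 r. ball x e) \<subseteq> {w. V w \<noteq> 0}"
    by (metis compact_cball compact_subset_open_imp_ball_epsilon_subset)
  have Vnz': "V w \<noteq> 0" if "w \<in> ball 0 (r + e)" for w
  proof (cases "cmod w \<le> r")
    case False
    define x where "x = of_real (r / cmod w) * w"
    have "w \<noteq> 0" using False r by auto
    have "cmod x = r" using \<open>w \<noteq> 0\<close> r by (simp add: x_def norm_mult norm_divide)
    moreover have "x - w = of_real (r / cmod w - 1) * w" by (simp add: x_def algebra_simps)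
    then have "cmod (x - w) = \<bar>r / cmod w - 1\<bar> * cmod w" by (simp only: norm_mult norm_of_real)
    then have "cmod (x - w) = cmod w - r" using False r \<open>w \<noteq> 0\<close>
      by (simp add: abs_if divide_simps split: if_splits)
    ultimately have "x \<in> cball 0 r" "w \<in> ball x e" using that by (auto simp: dist_norm)
    then show ?thesis using e(2) by blast
  qed (use Vnz in auto)
  obtain u where u: "u holomorphic_on ball 0 (r + e)" "\<And>w. w \<in> ball 0 (r + e) \<Longrightarrow> V w = exp (u w)"
    using holomorphic_logarithm_exists[of "ball 0 (r + e)" V 0] Vnz' holomorphic_on_subset[OF holV] r e(1)
    by (metis add_pos_pos centre_in_ball convex_ball open_ball subset_UNIV)
  have lnV: "ln (cmod (V w)) = Re (u w)" if "cmod w \<le> r" for w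
    using u(2)[of w] that e(1) by simp
  have "u holomorphic_on cball 0 r" by (rule holomorphic_on_subset[OF u(1)]) (use e(1) in auto)
  from Poisson_formula_holomorphic[OF this z]
  have "((\<lambda>t. Re (of_real ((r\<^sup>2 - (cmod z)\<^sup>2) / (cmod (of_real r * cis t - z))\<^sup>2) * u (of_real r * cis t)))
            has_integral Re (2 * of_real pi * u z)) {0..2*pi}"
    by (rule has_integral_Re)
  moreover have "Re (of_real ((r\<^sup>2 - (cmod z)\<^sup>2) / (cmod (of_real r * cis t - z))\<^sup>2) * u (of_real r * cis t)) =
     (r\<^sup>2 - (cmod z)\<^sup>2) / (cmod (of_real r * cis t - z))\<^sup>2 * ln (cmod (W (of_real r * cis t)))" for t
    using r by (subst eqs) (simp_all add: norm_mult lnV)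
  moreover have "Re (2 * of_real pi * u z) = 2 * pi * ln (cmod (V z))" using lnV[of z] z by simp
  ultimately have "((\<lambda>t. (r\<^sup>2 - (cmod z)\<^sup>2) / (cmod (of_real r * cis t - z))\<^sup>2 * ln (cmod (W (of_real r * cis t))))
     has_integral 2 * pi * ln (cmod (V z))) {0..2*pi}"
    by (simp only:)
  then have "integral {0..2*pi} (\<lambda>t. (r\<^sup>2 - (cmod z)\<^sup>2) / (cmod (of_real r * cis t - z))\<^sup>2 * ln (cmod (W (of_real r * cis t))))
     = 2 * pi * ln (cmod (V z))"
    by (rule integral_unique)
  moreover have "ln (cmod (W z)) \<le> ln (cmod (V z))" using le Wz by (intro ln_mono) auto
  ultimately show ?thesis by simp
qed

section \<open>Logarithmic derivatives\<close>

lemma deriv_prod_list_bound: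
  assumes "\<And>x. x \<in> set zs \<Longrightarrow> \<delta> \<le> cmod (z - x)" "\<delta> > 0"
  shows "cmod (deriv (\<lambda>z. \<Prod>x\<leftarrow>zs. z - x) z) \<le> real (length zs) / \<delta> * cmod (\<Prod>x\<leftarrow>zs. z - x)"
  using assms
proof (induction zs)
  case (Cons y zs)
  let ?p = "\<lambda>z. \<Prod>x\<leftarrow>zs. z - x"
  have hol: "?p holomorphic_on UNIV" by (intro holomorphic_intros)
  then have p: "(?p has_field_derivative deriv ?p z) (at z)" using holomorphic_derivI by blast
  have "((\<lambda>w. (w - y) * ?p w) has_field_derivative (?p z + deriv ?p z * (z - y))) (at z)"
    by (auto intro!: derivative_eq_intros p)
  then have "deriv (\<lambda>w. (w - y) * ?p w) z = ?p z + deriv ?p z * (z - y)"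
    by (rule DERIV_imp_deriv)
  then have "cmod (deriv (\<lambda>w. (w - y) * ?p w) z) \<le> cmod (?p z) + cmod (deriv ?p z) * cmod (z - y)"
    using norm_triangle_ineq[of "?p z" "deriv ?p z * (z - y)"] by (simp add: norm_mult)
  also have "\<dots> \<le> cmod (z - y) / \<delta> * cmod (?p z) + (real (length zs) / \<delta> * cmod (?p z)) * cmod (z - y)"
  proof (intro add_mono mult_right_mono)
    have "1 \<le> cmod (z - y) / \<delta>" using Cons.prems by simp
    then show "cmod (?p z) \<le> cmod (z - y) / \<delta> * cmod (?p z)"
      using mult_right_mono[of 1 "cmod (z - y) / \<delta>" "cmod (?p z)"] by simp
  qed (use Cons in auto)
  also have "\<dots> = real (length (y # zs)) / \<delta> * cmod ((z - y) * ?p z)"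
    unfolding norm_mult using Cons.prems(2) by (simp add: field_simps)
  finally show ?case by simp
qed auto

text \<open>The map u/(4K - u) sends the half-plane Re u < 2K into the unit disc and fixes 0, so
  Schwarz's lemma gives |v| <= 3/4 for |w| <= 3R/2. Solving for u, |u| = 4K|v|/|1 + v| <= 12K there,
  and Cauchy's estimate on discs of radius R/2 yields 24K/R.\<close>

lemma Borel_Caratheodory_deriv:
  assumes u: "u holomorphic_on ball 0 (2*R)" "u 0 = 0" and R: "R > 0"
    and K: "K > 0" "\<And>w. w \<in> ball 0 (2*R) \<Longrightarrow> Re (u w) \<le> K" and z: "cmod z \<le> R"
  shows "cmod (deriv u z) \<le> 24 * K / R"
proof -
  define v where "v = (\<lambda>\<xi>. u (of_real (2*R) * \<xi>) / (of_real (4*K) - u (of_real (2*R) * \<xi>)))"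
  have in2: "of_real (2*R) * \<xi> \<in> ball 0 (2*R)" if "cmod \<xi> < 1" for \<xi>
    using that R by (simp add: norm_mult)
  have nz: "of_real (4*K) - u (of_real (2*R) * \<xi>) \<noteq> 0" if "cmod \<xi> < 1" for \<xi>
  proof
    assume "of_real (4*K) - u (of_real (2*R) * \<xi>) = 0"
    then have "Re (u (of_real (2*R) * \<xi>)) = 4*K" by (metis Re_complex_of_real eq_iff_diff_eq_0)
    then show False using K(2)[OF in2[OF that]] K(1) by simp
  qed
  have lt: "cmod (v \<xi>) < 1" if "cmod \<xi> < 1" for \<xi>
  proof -
    define a where "a = u (of_real (2*R) * \<xi>)"
    have a: "Re a \<le> K" using K(2)[OF in2[OF that]] by (simp add: a_def)
    have "(cmod (of_real (4*K) - a))\<^sup>2 - (cmod a)\<^sup>2 = 8*K*(2*K - Re a)"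
      unfolding cmod_power2 by (simp add: power2_eq_square algebra_simps)
    also have "\<dots> > 0" using a K(1) by auto
    finally have "(cmod a)\<^sup>2 < (cmod (of_real (4*K) - a))\<^sup>2" by simp
    then have "cmod a < cmod (of_real (4*K) - a)" by (rule power2_less_imp_less) auto
    then show ?thesis using nz[OF that] by (simp add: v_def norm_divide a_def)
  qed
  have holv: "v holomorphic_on ball 0 1"
  proof -
    have "(\<lambda>\<xi>. u (of_real (2*R) * \<xi>)) holomorphic_on ball 0 1"
    proof (rule holomorphic_on_compose_gen[unfolded o_def, OF _ u(1)])
      show "(*) (complex_of_real (2*R)) ` ball 0 1 \<subseteq> ball 0 (2*R)" using in2 by auto
    qed (intro holomorphic_intros)
    then show ?thesis unfolding v_def by (intro holomorphic_intros) (use nz in auto)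
  qed
  have v0: "v 0 = 0" using u(2) by (simp add: v_def)
  have ub: "cmod (u w) \<le> 12 * K" if w: "cmod w \<le> 3/2*R" for w
  proof -
    define \<xi> where "\<xi> = w / of_real (2*R)"
    have \<xi>: "cmod \<xi> \<le> 3/4" using w R by (simp add: \<xi>_def norm_divide norm_mult field_simps)
    have we: "of_real (2*R) * \<xi> = w" using R by (simp add: \<xi>_def)
    have x1: "cmod \<xi> < 1" using \<xi> by simp
    have vb: "cmod (v \<xi>) \<le> 3/4" using Schwarz_Lemma(1)[OF holv v0 lt x1] \<xi> by simp
    define V where "V = v \<xi>"
    have "V * (of_real (4*K) - u w) = u w" using nz[OF x1] unfolding V_def v_def we by simp
    then have e: "u w * (1 + V) = of_real (4*K)*V" by (simp add: algebra_simps)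
    have "1/4 \<le> cmod (1 + V)" using norm_triangle_ineq2[of 1 "-V"] vb by (simp add: V_def)
    then have "cmod (u w) * (1/4) \<le> cmod (u w) * cmod (1 + V)" by (intro mult_left_mono) auto
    also have "\<dots> = 4*K*cmod V" using arg_cong[OF e, of cmod] K(1) by (simp add: norm_mult)
    also have "\<dots> \<le> 4*K*(3/4)" using vb K(1) by (intro mult_left_mono) (auto simp: V_def)
    finally show ?thesis by simp
  qed
  have sub: "cball z (R/2) \<subseteq> ball 0 (2*R)"
  proof
    fix w assume "w \<in> cball z (R/2)"
    then have "cmod w \<le> cmod z + R/2" by (metis add.commute cball_def dist_norm mem_Collect_eq
      norm_minus_commute norm_triangle_sub order_trans add_left_mono)
    then show "w \<in> ball 0 (2*R)" using z R by simp
  qed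
  have "cmod ((deriv ^^ 1) u z) \<le> fact 1 * (12*K) / (R/2) ^ 1"
  proof (rule Cauchy_inequality)
    show "u holomorphic_on ball z (R/2)" using holomorphic_on_subset[OF u(1)] sub ball_subset_cball by blast
    show "continuous_on (cball z (R/2)) u"
      by (rule continuous_on_subset[OF holomorphic_on_imp_continuous_on[OF u(1)] sub])
    fix x assume x: "cmod (z - x) = R/2"
    then have "cmod x \<le> cmod z + R/2" by (metis norm_minus_commute norm_triangle_sub)
    then show "cmod (u x) \<le> 12*K" using z by (intro ub) simp
  qed (use R in auto)
  then show ?thesis by simp
qed

text \<open>Splits \<open>h\<close> into its zeros in |x| <= 2R and a cofactor without zeros there:
  the zeros contribute at most their number divided by \<delta>, the cofactor 24K by
  Borel-Caratheodory. Distances are measured between moduli, so the condition on \<open>z\<close>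
  concerns only its radius and a whole circle can be chosen at once.\<close>

lemma entire_log_deriv_bound:
  assumes hol: "h holomorphic_on UNIV" and h0: "h 0 \<noteq> 0" and R: "R \<ge> 1" and K: "K > 0"
    and bound: "\<And>z. cmod z \<le> 6*R \<Longrightarrow> cmod (h z) \<le> exp K * cmod (h 0)"
  obtains zs where "real (length zs) \<le> 2 * K"
    "\<And>z \<delta>. cmod z \<le> R \<Longrightarrow> \<delta> > 0 \<Longrightarrow> (\<And>x. x \<in> set zs \<Longrightarrow> \<delta> \<le> \<bar>cmod z - cmod x\<bar>) \<Longrightarrow>
       h z \<noteq> 0 \<and> cmod (deriv h z) \<le> (2 * K / \<delta> + 24 * K) * cmod (h z)"
proof -
  obtain zs h1 where h1: "h1 holomorphic_on UNIV" and eq: "\<And>z. h z = (\<Prod>x\<leftarrow>zs. z - x) * h1 z"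
    and nz: "\<And>z. z \<in> cball 0 (2*R) \<Longrightarrow> h1 z \<noteq> 0" and zs: "set zs \<subseteq> cball 0 (2*R)"
    by (rule entire_zero_factorization[OF hol h0 compact_cball[of 0 "2*R"]]) blast
  define n where "n = length zs"
  define q where "q = (\<Prod>x\<leftarrow>zs. cmod x)"
  have q: "cmod (\<Prod>x\<leftarrow>zs. 0 - x) = q" unfolding prod_list_norm by (simp add: q_def)
  have h10: "h1 0 \<noteq> 0" using nz[of 0] R by auto
  have ch0: "cmod (h 0) = q * cmod (h1 0)" unfolding eq norm_mult q ..
  have q0: "q > 0" using ch0 h0 h10 by (metis norm_le_zero_iff norm_ge_zero not_less
      mult_nonpos_nonneg zero_less_norm_iff)
  \<comment> \<open>On |z| = 6R every listed zero satisfies |z - x| >= 4R >= 2|x|, so passing from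
    \<open>h\<close> to \<open>h1\<close> gains a factor 2 per zero relative to the value at 0. The
    maximum principle carries the bound to 0, where it reads 2^n <= exp K and counts the
    zeros.\<close>
  have b1: "cmod (h1 z) \<le> exp K * cmod (h1 0) / 2 ^ n" if "cmod z = 6*R" for z
  proof -
    have "2 ^ n * q = (\<Prod>x\<leftarrow>zs. 2 * cmod x)" unfolding n_def q_def by (induction zs) auto
    also have "\<dots> \<le> (\<Prod>x\<leftarrow>zs. cmod (z - x))"
    proof (rule prod_list_map_mono[THEN conjunct2])
      fix x assume "x \<in> set zs"
      then have "cmod x \<le> 2*R" using zs by auto
      moreover have "cmod z - cmod x \<le> cmod (z - x)" by (rule norm_triangle_ineq2)
      ultimately show "0 \<le> 2 * cmod x \<and> 2 * cmod x \<le> cmod (z - x)" using that by auto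
    qed
    finally have "2 ^ n * q * cmod (h1 z) \<le> cmod (h z)"
      unfolding eq norm_mult prod_list_norm by (intro mult_right_mono) auto
    also have "\<dots> \<le> exp K * (q * cmod (h1 0))" using bound[of z] that ch0 by auto
    finally have "q * (2 ^ n * cmod (h1 z)) \<le> q * (exp K * cmod (h1 0))" by (simp add: algebra_simps)
    then have "2 ^ n * cmod (h1 z) \<le> exp K * cmod (h1 0)" using q0 by simp
    then show ?thesis by (simp add: field_simps)
  qed
  have b2: "cmod (h1 z) \<le> exp K * cmod (h1 0) / 2 ^ n" if "cmod z \<le> 6*R" for z
  proof (rule maximum_modulus_frontier[of h1 "cball 0 (6*R)"])
    show "continuous_on (closure (cball 0 (6*R))) h1"
      by (rule continuous_on_subset[OF holomorphic_on_imp_continuous_on[OF h1]]) auto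
    show "h1 holomorphic_on interior (cball 0 (6*R))" by (rule holomorphic_on_subset[OF h1]) auto
    show "cmod (h1 z) \<le> exp K * cmod (h1 0) / 2 ^ n" if "z \<in> frontier (cball 0 (6*R))" for z
      using that b1[of z] R by (simp add: sphere_def)
  qed (use that in auto)
  have "1 \<le> exp K / 2 ^ n" using b2[of 0] h10 R by (simp add: field_simps)
  then have "2 ^ n \<le> exp K" by (simp add: field_simps)
  then have "ln (2 ^ n) \<le> ln (exp K)" by (intro ln_mono) auto
  then have "real n * ln 2 \<le> K" by (simp add: ln_realpow)
  moreover have "real n * (1/2) \<le> real n * ln 2" using ln_le_minus_one[of "1/2"] by (intro mult_left_mono) (auto simp: ln_div)
  ultimately have n: "real n \<le> 2 * K" by simp
  obtain u0 where u0: "u0 holomorphic_on ball 0 (2*R)" "\<And>w. w \<in> ball 0 (2*R) \<Longrightarrow> exp (u0 w) = h1 w"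
  proof (rule holomorphic_logarithm_exists[of "ball 0 (2*R)" h1 0])
    show "h1 holomorphic_on ball 0 (2*R)" by (rule holomorphic_on_subset[OF h1]) auto
  qed (use nz R in auto)
  define u where "u = (\<lambda>w. u0 w - u0 0)"
  have u: "u holomorphic_on ball 0 (2*R)" unfolding u_def by (intro holomorphic_intros u0)
  have eu: "h1 w = h1 0 * exp (u w)" if "w \<in> ball 0 (2*R)" for w
    using u0(2)[OF that] u0(2)[of 0] R h10 by (simp add: u_def exp_diff)
  have Reu: "Re (u w) \<le> K" if "w \<in> ball 0 (2*R)" for w
  proof -
    have "cmod (h1 0) * exp (Re (u w)) = cmod (h1 w)" using eu[OF that] by (simp add: norm_mult)
    also have "\<dots> \<le> exp K * cmod (h1 0) / 2 ^ n" using that R by (intro b2) auto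
    also have "\<dots> \<le> exp K * cmod (h1 0) / 1" by (intro divide_left_mono) auto
    finally have "exp (Re (u w)) \<le> exp K" using h10 by (simp add: mult.commute)
    then show ?thesis by simp
  qed
  have "h z \<noteq> 0 \<and> cmod (deriv h z) \<le> (2 * K / \<delta> + 24 * K) * cmod (h z)"
    if z: "cmod z \<le> R" and d: "\<delta> > 0" and dist: "\<And>x. x \<in> set zs \<Longrightarrow> \<delta> \<le> \<bar>cmod z - cmod x\<bar>" for z \<delta>
  proof -
    let ?p = "\<lambda>z. \<Prod>x\<leftarrow>zs. z - x"
    have dist': "\<delta> \<le> cmod (z - x)" if "x \<in> set zs" for x
      using dist[OF that] norm_triangle_ineq3[of z x] by linarith
    have zin: "z \<in> ball 0 (2*R)" using z R by simp
    have "?p z \<noteq> 0" using dist' d by (force simp: prod_list_zero_iff)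
    moreover have h1z: "h1 z \<noteq> 0" using nz[of z] zin by auto
    ultimately have hz: "h z \<noteq> 0" unfolding eq by simp
    have dh1: "deriv h1 z = h1 z * deriv u z"
    proof -
      have du: "(u has_field_derivative deriv u z) (at z)" using u zin holomorphic_derivI by blast
      have "((\<lambda>w. h1 0 * exp (u w)) has_field_derivative h1 0 * (exp (u z) * deriv u z)) (at z)"
        by (auto intro!: derivative_eq_intros du)
      then have "(h1 has_field_derivative h1 0 * (exp (u z) * deriv u z)) (at z)"
        by (rule has_field_derivative_transform_within_open[OF _ open_ball[of 0 "2*R"]])
           (use zin eu in auto)
      then show ?thesis using eu[OF zin] by (simp add: DERIV_imp_deriv mult.assoc)
    qed
    have "h = (\<lambda>z. ?p z * h1 z)" using eq by auto
    moreover have "?p holomorphic_on UNIV" by (intro holomorphic_intros)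
    ultimately have "deriv h z = ?p z * deriv h1 z + deriv ?p z * h1 z"
      using h1 by (simp add: holomorphic_on_imp_differentiable_at deriv_mult)
    then have "cmod (deriv h z) \<le> cmod (?p z * h1 z) * cmod (deriv u z) + cmod (deriv ?p z) * cmod (h1 z)"
      using norm_triangle_ineq[of "?p z * deriv h1 z" "deriv ?p z * h1 z"]
      by (simp add: norm_mult dh1 mult.assoc)
    also have "\<dots> \<le> cmod (?p z * h1 z) * (24 * K) + (real n / \<delta> * cmod (?p z)) * cmod (h1 z)"
    proof (intro add_mono mult_left_mono mult_right_mono)
      have "cmod (deriv u z) \<le> 24 * K / R"
        by (rule Borel_Caratheodory_deriv[OF u]) (use R K Reu z in \<open>auto simp: u_def\<close>)
      also have "\<dots> \<le> 24 * K / 1" using R K by (intro divide_left_mono) auto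
      finally show "cmod (deriv u z) \<le> 24 * K" by simp
      show "cmod (deriv ?p z) \<le> real n / \<delta> * cmod (?p z)"
        unfolding n_def by (rule deriv_prod_list_bound[OF dist' d])
    qed auto
    also have "\<dots> = (real n / \<delta> + 24 * K) * cmod (h z)" unfolding eq norm_mult by (simp add: algebra_simps)
    also have "\<dots> \<le> (2 * K / \<delta> + 24 * K) * cmod (h z)"
      using n d by (intro mult_right_mono add_mono divide_right_mono) auto
    finally show ?thesis using hz by simp
  qed
  with n show ?thesis using that[of zs] unfolding n_def by blast
qed

text \<open>Pigeonhole: of card X + 1 equal open subintervals one misses \<open>X\<close>, and its
  middle half stays a quarter of its length away from \<open>X\<close>. That half is infinite, so
  the finite set \<open>Y\<close> can be avoided too, though without a quantitative gap.\<close>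

lemma ex_real_avoiding:
  fixes X :: "real set"
  assumes "finite X" "finite Y" "a < b"
  obtains r where "a \<le> r" "r \<le> b" "\<And>x. x \<in> X \<Longrightarrow> (b - a) / (4 * (real (card X) + 1)) \<le> \<bar>r - x\<bar>" "r \<notin> Y"
proof -
  define N where "N = card X + 1"
  define l where "l = (b - a) / real N"
  have N: "real N = real (card X) + 1" "real N > 0" by (auto simp: N_def)
  have l: "l > 0" using assms by (simp add: l_def N_def)
  have lN: "l * real N = b - a" by (simp add: l_def N_def)
  define I where "I = (\<lambda>i::nat. {a + l * real i <..< a + l * real i + l})"
  have disj: "I i \<inter> I j = {}" if "i < j" for i j
  proof -
    have "real i + 1 \<le> real j" using that by simp
    then have "l * (real i + 1) \<le> l * real j" using l by (intro mult_left_mono) auto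
    then show ?thesis by (auto simp: I_def algebra_simps)
  qed
  have "\<exists>i<N. X \<inter> I i = {}"
  proof (rule ccontr)
    assume "\<not> ?thesis"
    then have "\<forall>i\<in>{..<N}. \<exists>x. x \<in> X \<inter> I i" by auto
    then obtain \<phi> where phi: "\<And>i. i < N \<Longrightarrow> \<phi> i \<in> X \<inter> I i" by (metis lessThan_iff)
    have "inj_on \<phi> {..<N}"
    proof (rule inj_onI)
      fix i j assume ij: "i \<in> {..<N}" "j \<in> {..<N}" "\<phi> i = \<phi> j"
      show "i = j"
      proof (rule ccontr)
        assume "i \<noteq> j"
        then have "I i \<inter> I j = {}" using disj[of i j] disj[of j i] by (auto simp: neq_iff)
        then show False using phi[of i] phi[of j] ij by auto
      qed
    qed
    moreover have "\<phi> ` {..<N} \<subseteq> X" using phi by auto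
    ultimately have "card {..<N} \<le> card X" using assms(1) by (metis card_inj_on_le)
    then show False by (simp add: N_def)
  qed
  then obtain i where i: "i < N" "X \<inter> I i = {}" by blast
  define c where "c = a + l * real i"
  have "infinite {c + l/4 <..< c + 3*l/4}" using l by (intro infinite_Ioo) simp
  then have "infinite ({c + l/4 <..< c + 3*l/4} - Y)" using assms(2) by (rule Diff_infinite_finite[rotated])
  then obtain r where r: "r \<in> {c + l/4 <..< c + 3*l/4} - Y" by (metis finite.emptyI ex_in_conv)
  have "l * real i \<ge> 0" using l by simp
  moreover have "l * (real i + 1) \<le> l * real N" using i(1) l by (intro mult_left_mono) auto
  ultimately have ab: "a \<le> c" "c + l \<le> b" using lN by (auto simp: c_def algebra_simps)
  have l4: "(b - a) / (4 * (real (card X) + 1)) = l / 4" by (simp add: l_def N)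
  show ?thesis
  proof (rule that[of r])
    fix x assume "x \<in> X"
    then have "x \<notin> I i" using i by auto
    then have "x \<le> c \<or> x \<ge> c + l" by (auto simp: I_def c_def)
    then show "(b - a) / (4 * (real (card X) + 1)) \<le> \<bar>r - x\<bar>" using r l unfolding l4 by auto
  qed (use r ab l in auto)
qed

section \<open>Growth estimates\<close>

lemma lnplus_conv_max: "lnplus x = ln (max 1 x)"
  by (auto simp: lnplus_def max_def)

lemma lnplus_nonneg: "lnplus x \<ge> 0"
  by (simp add: lnplus_conv_max)

lemma ln_le_lnplus: "x > 0 \<Longrightarrow> ln x \<le> lnplus x"
  by (simp add: lnplus_conv_max)

lemma lnplus_le_ln_add1: "x \<ge> 0 \<Longrightarrow> lnplus x \<le> ln (1 + x)"
  unfolding lnplus_conv_max by (intro ln_mono) auto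

lemma continuous_on_entire_circle:
  assumes "f holomorphic_on UNIV"
  shows "continuous_on A (\<lambda>t. f (of_real r * cis t))"
  by (intro continuous_on_compose2[OF holomorphic_on_imp_continuous_on[OF assms]] continuous_intros) auto

lemma continuous_on_lnplus_circle:
  assumes "f holomorphic_on UNIV"
  shows "continuous_on A (\<lambda>t. lnplus (cmod (f (of_real r * cis t))))"
  unfolding lnplus_conv_max
  by (intro continuous_intros continuous_on_entire_circle assms) (auto simp: max_def)

lemma continuous_on_ln_circle:
  assumes "f holomorphic_on UNIV" "\<And>w. cmod w = r \<Longrightarrow> f w \<noteq> 0" "r \<ge> 0"
  shows "continuous_on A (\<lambda>t. ln (cmod (f (of_real r * cis t))))"
  using assms by (intro continuous_intros continuous_on_entire_circle) (auto simp: norm_mult)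

lemma nev_T_entire_nonneg:
  assumes "f holomorphic_on UNIV"
  shows "nev_T_entire f r \<ge> 0"
  unfolding nev_T_entire_def
  by (intro divide_nonneg_nonneg integral_nonneg integrable_continuous_interval continuous_on_lnplus_circle assms)
     (auto simp: lnplus_nonneg)

text \<open>Since |w - z| >= r - s with s = |z|, the kernel is at most (r + s)/(r - s), which
  reaches 3 at s = r/2.\<close>

lemma Poisson_kernel_le_3:
  assumes "cmod w = r" "cmod z \<le> r / 2" "r > 0"
  shows "0 \<le> (r\<^sup>2 - (cmod z)\<^sup>2) / (cmod (w - z))\<^sup>2" "(r\<^sup>2 - (cmod z)\<^sup>2) / (cmod (w - z))\<^sup>2 \<le> 3"
proof -
  define s where "s = cmod z"
  have s: "s \<ge> 0" "s \<le> r/2" using assms by (auto simp: s_def)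
  have "s * s \<le> r * r" using s assms by (intro mult_mono) auto
  then show "0 \<le> (r\<^sup>2 - (cmod z)\<^sup>2) / (cmod (w - z))\<^sup>2" by (simp add: power2_eq_square s_def)
  have ge: "r - s \<le> cmod (w - z)" using norm_triangle_ineq2[of w z] assms by (simp add: s_def)
  then have "(r - s)\<^sup>2 \<le> (cmod (w - z))\<^sup>2" using s assms(3) by (intro power_mono) auto
  moreover have "r\<^sup>2 - s\<^sup>2 \<le> 3 * (r - s)\<^sup>2"
  proof -
    have "3 * (r - s)\<^sup>2 - (r\<^sup>2 - s\<^sup>2) = (r - s) * (2 * r - 4 * s)" by (simp add: power2_eq_square algebra_simps)
    moreover have "(r - s) * (2 * r - 4 * s) \<ge> 0" using s assms(3) by (intro mult_nonneg_nonneg) auto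
    ultimately show ?thesis by simp
  qed
  ultimately have "r\<^sup>2 - s\<^sup>2 \<le> 3 * (cmod (w - z))\<^sup>2" by linarith
  moreover have "cmod (w - z) > 0" using ge s assms(3) by linarith
  ultimately show "(r\<^sup>2 - (cmod z)\<^sup>2) / (cmod (w - z))\<^sup>2 \<le> 3" by (simp add: s_def field_simps)
qed

text \<open>The classical comparison log M(r/2) <= 3 T(r): the kernel is at most 3 and ln is at most
  its positive part. It serves to return from characteristics to pointwise bounds.\<close>

lemma ln_le_3_nev_T:
  assumes f: "f holomorphic_on UNIV" and bd: "\<And>w. cmod w = r \<Longrightarrow> f w \<noteq> 0"
    and z: "cmod z \<le> r / 2" and r: "r > 0" and fz: "f z \<noteq> 0"
  shows "ln (cmod (f z)) \<le> 3 * nev_T_entire f r"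
proof -
  let ?P = "\<lambda>t. (r\<^sup>2 - (cmod z)\<^sup>2) / (cmod (of_real r * cis t - z))\<^sup>2"
  have zr: "cmod z < r" using z r by simp
  have P: "0 \<le> ?P t" "?P t \<le> 3" for t
    using Poisson_kernel_le_3[of "of_real r * cis t" r z] z r by (auto simp: norm_mult)
  have ne: "of_real r * cis t - z \<noteq> 0" for t
  proof
    assume "of_real r * cis t - z = 0"
    then have "cmod (of_real r * cis t) = cmod z" by simp
    then show False using zr r by (simp add: norm_mult)
  qed
  have "2 * pi * ln (cmod (f z)) \<le> integral {0..2*pi} (\<lambda>t. ?P t * ln (cmod (f (of_real r * cis t))))"
    by (rule Poisson_Jensen_inequality[OF f bd zr fz])
  also have "\<dots> \<le> integral {0..2*pi} (\<lambda>t. 3 * lnplus (cmod (f (of_real r * cis t))))"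
  proof (rule integral_le)
    show "(\<lambda>t. ?P t * ln (cmod (f (of_real r * cis t)))) integrable_on {0..2*pi}"
      by (intro integrable_continuous_interval continuous_intros continuous_on_ln_circle f bd)
         (use ne r in auto)
    show "(\<lambda>t. 3 * lnplus (cmod (f (of_real r * cis t)))) integrable_on {0..2*pi}"
      by (intro integrable_continuous_interval continuous_intros continuous_on_lnplus_circle f)
    fix t
    have "f (of_real r * cis t) \<noteq> 0" using bd r by (simp add: norm_mult)
    then have "?P t * ln (cmod (f (of_real r * cis t))) \<le> ?P t * lnplus (cmod (f (of_real r * cis t)))"
      by (intro mult_left_mono ln_le_lnplus P) auto
    also have "\<dots> \<le> 3 * lnplus (cmod (f (of_real r * cis t)))"
      by (intro mult_right_mono P lnplus_nonneg)
    finally show "?P t * ln (cmod (f (of_real r * cis t))) \<le> 3 * lnplus (cmod (f (of_real r * cis t)))" .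
  qed
  also have "\<dots> = 2 * pi * (3 * nev_T_entire f r)" by (simp add: nev_T_entire_def)
  finally show ?thesis by simp
qed

text \<open>Jensen's inequality at the centre, where the kernel is 1. The pointwise bound enters as
  ln |W| <= ln B - ln(1 + |f|) - ln(1 + |g|), which puts both characteristics on the other
  side.\<close>

lemma nev_T_add_le_ln:
  assumes hol: "W holomorphic_on UNIV" "f holomorphic_on UNIV" "g holomorphic_on UNIV"
    and bd: "\<And>w. cmod w = r \<Longrightarrow> W w \<noteq> 0" and r: "r > 0" and W0: "W 0 \<noteq> 0" and B: "B > 0"
    and le: "\<And>w. cmod w = r \<Longrightarrow> cmod (W w) * (1 + cmod (f w)) * (1 + cmod (g w)) \<le> B"
  shows "nev_T_entire f r + nev_T_entire g r \<le> ln (B / cmod (W 0))"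
proof -
  let ?w = "\<lambda>t. of_real r * cis t"
  have w: "cmod (?w t) = r" for t using r by (simp add: norm_mult)
  have "2 * pi * ln (cmod (W 0)) \<le> integral {0..2*pi} (\<lambda>t. (r\<^sup>2 - (cmod 0)\<^sup>2) / (cmod (?w t - 0))\<^sup>2 * ln (cmod (W (?w t))))"
    by (rule Poisson_Jensen_inequality[OF hol(1) bd _ W0]) (use r in auto)
  also have "\<dots> = integral {0..2*pi} (\<lambda>t. ln (cmod (W (?w t))))"
    using r by (simp add: norm_mult)
  also have "\<dots> \<le> integral {0..2*pi} (\<lambda>t. ln B - lnplus (cmod (f (?w t))) - lnplus (cmod (g (?w t))))"
  proof (rule integral_le)
    show "(\<lambda>t. ln (cmod (W (?w t)))) integrable_on {0..2*pi}"
      by (intro integrable_continuous_interval continuous_on_ln_circle hol bd) (use r in auto)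
    show "(\<lambda>t. ln B - lnplus (cmod (f (?w t))) - lnplus (cmod (g (?w t)))) integrable_on {0..2*pi}"
      by (intro integrable_continuous_interval continuous_intros continuous_on_lnplus_circle hol)
    fix t
    have Wn: "W (?w t) \<noteq> 0" using bd w by blast
    have p: "1 + cmod (f (?w t)) > 0" "1 + cmod (g (?w t)) > 0" by (simp_all add: add_pos_nonneg)
    have "ln (cmod (W (?w t))) + ln (1 + cmod (f (?w t))) + ln (1 + cmod (g (?w t))) =
      ln (cmod (W (?w t)) * (1 + cmod (f (?w t))) * (1 + cmod (g (?w t))))"
      using Wn p by (simp add: ln_mult)
    also have "\<dots> \<le> ln B" using le[OF w, of t] Wn p by (intro ln_mono mult_pos_pos) auto
    finally show "ln (cmod (W (?w t))) \<le> ln B - lnplus (cmod (f (?w t))) - lnplus (cmod (g (?w t)))"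
      using lnplus_le_ln_add1[of "cmod (f (?w t))"] lnplus_le_ln_add1[of "cmod (g (?w t))"] by simp
  qed
  also have "\<dots> = 2 * pi * ln B - integral {0..2*pi} (\<lambda>t. lnplus (cmod (f (?w t)))) - integral {0..2*pi} (\<lambda>t. lnplus (cmod (g (?w t))))"
    by (simp add: integral_diff integrable_diff integrable_continuous_interval continuous_on_lnplus_circle hol)
  also have "\<dots> = 2 * pi * (ln B - nev_T_entire f r - nev_T_entire g r)"
    by (simp add: nev_T_entire_def field_simps)
  finally have "ln (cmod (W 0)) \<le> ln B - nev_T_entire f r - nev_T_entire g r" by simp
  then show ?thesis using W0 B by (simp add: ln_div)
qed

lemma finite_zeros_cball:
  fixes h :: "complex \<Rightarrow> complex"
  assumes "h holomorphic_on UNIV" "h w0 \<noteq> 0"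
  shows "finite {z. cmod z \<le> R \<and> h z = 0}"
  using finite_zeros_compact[OF assms compact_cball[of 0 R]] by simp

text \<open>A bound exp \<mu> on a large disc makes the logarithmic derivatives O(\<mu>^2) on a
  suitable circle, so \<open>main\<close> and Jensen's inequality for \<open>W\<close> bound both
  characteristics by O(1 + ln \<mu>). Radii: the functions in \<open>Hs\<close> are needed up to 6R
  and \<open>growth\<close> costs one unit more, which fits into 7R; the circle has radius at least
  R/2 and its characteristic controls half of it, leaving R/4.\<close>

lemma growth_step:
  fixes f g W :: "complex \<Rightarrow> complex" and Hs :: "(complex \<Rightarrow> complex) set"
  assumes hol: "f holomorphic_on UNIV" "g holomorphic_on UNIV" "W holomorphic_on UNIV"
    and nz: "f zf \<noteq> 0" "g zg \<noteq> 0" "W 0 \<noteq> 0"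
    and Hs: "finite Hs" "\<And>h. h \<in> Hs \<Longrightarrow> h holomorphic_on UNIV" "\<And>h. h \<in> Hs \<Longrightarrow> h 0 \<noteq> 0"
    and A: "A > 0"
    and main: "\<And>z \<Lambda>. \<Lambda> \<ge> 1 \<Longrightarrow> (\<And>h. h \<in> Hs \<Longrightarrow> h z \<noteq> 0 \<and> cmod (deriv h z) \<le> \<Lambda> * cmod (h z)) \<Longrightarrow>
           cmod (W z) * (1 + cmod (f z)) * (1 + cmod (g z)) \<le> A * \<Lambda> ^ p"
    and B: "B \<ge> 1"
    and growth: "\<And>h R \<mu> z. h \<in> Hs \<Longrightarrow> \<mu> \<ge> 1 \<Longrightarrow>
        (\<And>w. cmod w \<le> R + 1 \<Longrightarrow> cmod (f w) \<le> exp \<mu> \<and> cmod (g w) \<le> exp \<mu>) \<Longrightarrow>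
        cmod z \<le> R \<Longrightarrow> cmod (h z) \<le> exp (B * \<mu>)"
  obtains C N where "C \<ge> 1" "\<And>R \<mu> z. R \<ge> 1 \<Longrightarrow> \<mu> \<ge> 1 \<Longrightarrow>
      (\<And>w. cmod w \<le> 7 * R \<Longrightarrow> cmod (f w) \<le> exp \<mu> \<and> cmod (g w) \<le> exp \<mu>) \<Longrightarrow>
      cmod z \<le> R / 4 \<Longrightarrow> cmod (f z) \<le> C * \<mu> ^ N \<and> cmod (g z) \<le> C * \<mu> ^ N"
proof -
  define m where "m = real (card Hs)"
  \<comment> \<open>Absorbs the values ln |h(0)|, so that the normalised bound exp K * |h(0)| holds
    with K = (B + E) \<mu> for every h in \<open>Hs\<close> at once.\<close>
  define E where "E = (\<Sum>h\<in>Hs. \<bar>ln (cmod (h 0))\<bar>)"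
  have E0: "E \<ge> 0" by (simp add: E_def sum_nonneg)
  have E: "- E \<le> ln (cmod (h 0))" if "h \<in> Hs" for h
  proof -
    have "\<bar>ln (cmod (h 0))\<bar> \<le> E" unfolding E_def
      by (rule member_le_sum[OF that _ Hs(1)]) auto
    then show ?thesis by linarith
  qed
  \<comment> \<open>Chosen to give \<Lambda> <= c \<mu>^2 below: with \<delta> = 1/(8(2Km + 1)) one
    has 2K/\<delta> + 24K = 32mK^2 + 40K, and K <= K^2.\<close>
  define c where "c = (32 * m + 40) * (B + E)\<^sup>2"
  define C where "C = max 1 ((A * c ^ p / cmod (W 0)) ^ 3)"
  have bound: "cmod (f z) \<le> C * \<mu> ^ (6 * p) \<and> cmod (g z) \<le> C * \<mu> ^ (6 * p)"
    if R: "R \<ge> 1" and mu: "\<mu> \<ge> 1"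
      and fg: "\<And>w. cmod w \<le> 7 * R \<Longrightarrow> cmod (f w) \<le> exp \<mu> \<and> cmod (g w) \<le> exp \<mu>"
      and z: "cmod z \<le> R / 4" for R \<mu> z
  proof -
    define K where "K = (B + E) * \<mu>"
    have "1 * 1 \<le> (B + E) * \<mu>" using B E0 mu by (intro mult_mono) auto
    then have K: "K \<ge> 1" by (simp add: K_def)
    have "\<exists>zs. real (length zs) \<le> 2 * K \<and>
       (\<forall>z \<delta>. cmod z \<le> R \<longrightarrow> \<delta> > 0 \<longrightarrow> (\<forall>x \<in> set zs. \<delta> \<le> \<bar>cmod z - cmod x\<bar>) \<longrightarrow>
         h z \<noteq> 0 \<and> cmod (deriv h z) \<le> (2 * K / \<delta> + 24 * K) * cmod (h z))" if h: "h \<in> Hs" for h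
    proof (rule entire_log_deriv_bound[OF Hs(2)[OF h] Hs(3)[OF h] R, of K])
      show "K > 0" using K by simp
      fix w assume w: "cmod w \<le> 6 * R"
      have "cmod (h w) \<le> exp (B * \<mu>)"
        by (rule growth[OF h mu _ w]) (use fg R in auto)
      also have "B * \<mu> \<le> K + ln (cmod (h 0))"
      proof -
        have "E * 1 \<le> E * \<mu>" using E0 mu by (intro mult_left_mono) auto
        then show ?thesis using E[OF h] by (simp add: K_def algebra_simps)
      qed
      then have "exp (B * \<mu>) \<le> exp (K + ln (cmod (h 0)))" by simp
      also have "\<dots> = exp K * cmod (h 0)" using Hs(3)[OF h] by (simp add: exp_add)
      finally show "cmod (h w) \<le> exp K * cmod (h 0)" by simp
    qed blast
    then obtain zs where zs: "\<And>h. h \<in> Hs \<Longrightarrow> real (length (zs h)) \<le> 2 * K"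
      "\<And>h z \<delta>. h \<in> Hs \<Longrightarrow> cmod z \<le> R \<Longrightarrow> \<delta> > 0 \<Longrightarrow> (\<forall>x \<in> set (zs h). \<delta> \<le> \<bar>cmod z - cmod x\<bar>) \<Longrightarrow>
         h z \<noteq> 0 \<and> cmod (deriv h z) \<le> (2 * K / \<delta> + 24 * K) * cmod (h z)"
      by metis
    define X where "X = (\<Union>h\<in>Hs. cmod ` set (zs h))"
    have finX: "finite X" using Hs(1) by (auto simp: X_def)
    have "card X \<le> (\<Sum>h\<in>Hs. card (cmod ` set (zs h)))"
      unfolding X_def by (rule card_UN_le[OF Hs(1)])
    also have "\<dots> \<le> (\<Sum>h\<in>Hs. length (zs h))"
      by (intro sum_mono) (metis List.finite_set card_image_le card_length order_trans)
    finally have "real (card X) \<le> real (\<Sum>h\<in>Hs. length (zs h))" by linarith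
    also have "\<dots> \<le> (\<Sum>h\<in>Hs. 2 * K)" unfolding of_nat_sum by (intro sum_mono zs)
    also have "\<dots> = 2 * K * m" by (simp add: m_def)
    finally have cX: "real (card X) \<le> 2 * K * m" .
    \<comment> \<open>These moduli only have to be missed, not kept at a distance: the
      Poisson-Jensen inequality is used for \<open>W\<close>, \<open>f\<close> and \<open>g\<close>
      on a circle free of their zeros.\<close>
    define Y where "Y = cmod ` ({z. cmod z \<le> R \<and> W z = 0} \<union> {z. cmod z \<le> R \<and> f z = 0} \<union> {z. cmod z \<le> R \<and> g z = 0})"
    have finY: "finite Y" unfolding Y_def
      using finite_zeros_cball[OF hol(1) nz(1)] finite_zeros_cball[OF hol(2) nz(2)]
        finite_zeros_cball[OF hol(3) nz(3)] by auto
    obtain r where r: "R / 2 \<le> r" "r \<le> R" "r \<notin> Y"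
      and rX: "\<And>x. x \<in> X \<Longrightarrow> (R - R / 2) / (4 * (real (card X) + 1)) \<le> \<bar>r - x\<bar>"
      using ex_real_avoiding[OF finX finY, of "R/2" R] R by auto
    define \<delta> where "\<delta> = 1 / (8 * (2 * K * m + 1))"
    have m0: "m \<ge> 0" by (simp add: m_def)
    have Km: "2 * K * m + 1 > 0" using K m0 by (simp add: add_nonneg_pos)
    then have d0: "\<delta> > 0" by (simp add: \<delta>_def)
    have dX: "\<delta> \<le> \<bar>r - x\<bar>" if "x \<in> X" for x
    proof -
      have "\<delta> \<le> 1 / (8 * (real (card X) + 1))"
        unfolding \<delta>_def using cX by (intro divide_left_mono) (auto intro!: mult_pos_pos add_nonneg_pos simp: Km)
      also have "\<dots> \<le> R / (8 * (real (card X) + 1))" using R by (intro divide_right_mono) auto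
      also have "\<dots> = (R - R / 2) / (4 * (real (card X) + 1))" by (simp add: field_simps)
      also have "\<dots> \<le> \<bar>r - x\<bar>" by (rule rX[OF that])
      finally show ?thesis .
    qed
    define \<Lambda> where "\<Lambda> = 2 * K / \<delta> + 24 * K"
    have L1: "\<Lambda> \<ge> 1" using K d0 by (simp add: \<Lambda>_def add_increasing)
    have KK: "K \<le> K\<^sup>2" using K by (simp add: power2_eq_square)
    have "\<Lambda> = 32 * m * K\<^sup>2 + 40 * K" using Km by (simp add: \<Lambda>_def \<delta>_def field_simps power2_eq_square)
    also have "\<dots> \<le> (32 * m + 40) * K\<^sup>2" using KK by (simp add: algebra_simps)
    also have "\<dots> = c * \<mu>\<^sup>2" by (simp add: c_def K_def power_mult_distrib)
    finally have L2: "\<Lambda> \<le> c * \<mu>\<^sup>2" .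
    have circle: "cmod (W w) * (1 + cmod (f w)) * (1 + cmod (g w)) \<le> A * \<Lambda> ^ p" if w: "cmod w = r" for w
    proof (rule main[OF L1])
      fix h assume h: "h \<in> Hs"
      show "h w \<noteq> 0 \<and> cmod (deriv h w) \<le> \<Lambda> * cmod (h w)"
        unfolding \<Lambda>_def by (rule zs(2)[OF h _ d0]) (use w r(2) dX h in \<open>auto simp: X_def\<close>)
    qed
    have nzr: "W w \<noteq> 0" "f w \<noteq> 0" "g w \<noteq> 0" if "cmod w = r" for w
      using r(2,3) that by (auto simp: Y_def)
    have rp: "r > 0" using r R by linarith
    have AL: "A * \<Lambda> ^ p > 0" using A L1 by simp
    have T: "nev_T_entire f r + nev_T_entire g r \<le> ln (A * \<Lambda> ^ p / cmod (W 0))"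
      by (rule nev_T_add_le_ln[OF hol(3,1,2) nzr(1) rp nz(3) AL circle])
    \<comment> \<open>The cube comes from the factor 3 in front of the characteristic; together with
      \<Lambda>^p <= (c \<mu>^2)^p it produces the exponent 6p. Each of \<open>f\<close> and
      \<open>g\<close> qualifies for \<open>k\<close> because the other characteristic is
      nonnegative.\<close>
    have final: "cmod (k z) \<le> C * \<mu> ^ (6 * p)"
      if k: "k holomorphic_on UNIV" "\<And>w. cmod w = r \<Longrightarrow> k w \<noteq> 0"
        "nev_T_entire k r \<le> ln (A * \<Lambda> ^ p / cmod (W 0))" for k
    proof (cases "k z = 0")
      case True
      then show ?thesis using mu by (simp add: C_def)
    next
      case False
      have pos: "A * \<Lambda> ^ p / cmod (W 0) > 0" using AL nz(3) by simp
      have "ln (cmod (k z)) \<le> 3 * nev_T_entire k r"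
        by (rule ln_le_3_nev_T[OF k(1,2) _ rp False]) (use z r in auto)
      also have "\<dots> \<le> 3 * ln (A * \<Lambda> ^ p / cmod (W 0))" using k(3) by simp
      also have "\<dots> = ln ((A * \<Lambda> ^ p / cmod (W 0)) ^ 3)" using pos by (subst ln_realpow) auto
      finally have "cmod (k z) \<le> (A * \<Lambda> ^ p / cmod (W 0)) ^ 3"
        using False pos by (subst (asm) ln_le_cancel_iff) auto
      also have "\<dots> \<le> (A * (c * \<mu>\<^sup>2) ^ p / cmod (W 0)) ^ 3"
        using A L1 L2 by (intro power_mono divide_right_mono mult_left_mono) auto
      also have "\<dots> = (A * c ^ p / cmod (W 0)) ^ 3 * \<mu> ^ (6 * p)"
        by (simp add: power_mult_distrib power_divide flip: power_mult)
      also have "\<dots> \<le> C * \<mu> ^ (6 * p)" using mu by (intro mult_right_mono) (auto simp: C_def)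
      finally show ?thesis .
    qed
    show ?thesis
      using final[OF hol(1) nzr(2)] final[OF hol(2) nzr(3)] T
        nev_T_entire_nonneg[OF hol(1), of r] nev_T_entire_nonneg[OF hol(2), of r] by simp
  qed
  show ?thesis by (rule that[of C "6*p"]) (use bound in \<open>auto simp: C_def\<close>)
qed

text \<open>In the first pass the radius is 28R, so the starting bound is needed up to 196R, where
  c(|w| + 1) <= 224cR; the result is exp(D R). The second pass takes \<mu> = 4D|z|, obtains a power
  of |z|, and Liouville finishes. \<open>g\<close> is carried along since every pass needs bounds
  for both functions.\<close>

lemma polynomial_of_growth_step:
  fixes f g :: "complex \<Rightarrow> complex"
  assumes f: "f holomorphic_on UNIV"
    and c: "c \<ge> 1" "\<And>z. cmod (f z) \<le> exp (exp (c * (cmod z + 1)))" "\<And>z. cmod (g z) \<le> exp (exp (c * (cmod z + 1)))"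
    and C: "C \<ge> 1"
    and step: "\<And>R \<mu> z. R \<ge> 1 \<Longrightarrow> \<mu> \<ge> 1 \<Longrightarrow>
      (\<And>w. cmod w \<le> 7 * R \<Longrightarrow> cmod (f w) \<le> exp \<mu> \<and> cmod (g w) \<le> exp \<mu>) \<Longrightarrow>
      cmod z \<le> R / 4 \<Longrightarrow> cmod (f z) \<le> C * \<mu> ^ N \<and> cmod (g z) \<le> C * \<mu> ^ N"
  shows "\<exists>p. \<forall>z. f z = poly p z"
proof -
  define D where "D = ln C + 224 * c * real N + 1"
  have lnC: "ln C \<ge> 0" using C by simp
  have D1: "D \<ge> 1" using lnC c(1) by (simp add: D_def)
  have first: "cmod (f z) \<le> exp (D * R) \<and> cmod (g z) \<le> exp (D * R)"
    if R: "R \<ge> 1" and z: "cmod z \<le> 7 * R" for R z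
  proof -
    define \<mu> where "\<mu> = exp (c * (224 * R))"
    have "cmod (f z) \<le> C * \<mu> ^ N \<and> cmod (g z) \<le> C * \<mu> ^ N"
    proof (rule step[of "28 * R"])
      show "\<mu> \<ge> 1" using c(1) R by (simp add: \<mu>_def)
      fix w assume w: "cmod w \<le> 7 * (28 * R)"
      have "c * (cmod w + 1) \<le> c * (224 * R)" using w R c(1) by (intro mult_left_mono) auto
      then have "exp (exp (c * (cmod w + 1))) \<le> exp \<mu>" by (simp add: \<mu>_def)
      then show "cmod (f w) \<le> exp \<mu> \<and> cmod (g w) \<le> exp \<mu>" using c(2,3)[of w] by linarith
    qed (use R z in auto)
    moreover have "C * \<mu> ^ N \<le> exp (D * R)"
    proof -
      have "C * \<mu> ^ N = exp (ln C + real N * (c * (224 * R)))"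
        using C by (simp add: \<mu>_def exp_add exp_of_nat_mult)
      also have "ln C + real N * (c * (224 * R)) \<le> D * R"
      proof -
        have "ln C * 1 \<le> ln C * R" using lnC R by (intro mult_left_mono) auto
        then show ?thesis using R by (simp add: D_def algebra_simps)
      qed
      finally show ?thesis by simp
    qed
    ultimately show ?thesis by linarith
  qed
  have second: "cmod (f z) \<le> C * (4 * D) ^ N * cmod z ^ N" if z: "1 \<le> cmod z" for z
  proof -
    have "cmod (f z) \<le> C * (D * (4 * cmod z)) ^ N \<and> cmod (g z) \<le> C * (D * (4 * cmod z)) ^ N"
    proof (rule step[of "4 * cmod z"])
      have "1 * 1 \<le> D * (4 * cmod z)" using D1 z by (intro mult_mono) auto
      then show "1 \<le> D * (4 * cmod z)" by simp
      show "cmod (f w) \<le> exp (D * (4 * cmod z)) \<and> cmod (g w) \<le> exp (D * (4 * cmod z))"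
        if "cmod w \<le> 7 * (4 * cmod z)" for w
        by (rule first) (use that z in auto)
    qed (use z in auto)
    then show ?thesis by (simp add: power_mult_distrib mult_ac)
  qed
  have "f z = (\<Sum>k\<le>N. (deriv ^^ k) f 0 / fact k * z ^ k)" for z
    by (rule Liouville_polynomial[OF f second])
  then have "f z = poly (\<Sum>k\<le>N. monom ((deriv ^^ k) f 0 / fact k) k) z" for z
    by (simp add: poly_sum poly_monom)
  then show ?thesis by blast
qed

text \<open>Hyper-order below 1 means T(r) <= exp r for large r, and ln |f(z)| <= 3 T(r) on a
  zero-free circle of radius between 2|z| + q and 2|z| + q + 1 turns this into a pointwise
  bound.\<close>

lemma hyper_order_growth:
  assumes f: "f holomorphic_on UNIV" and ho: "hyper_order_entire f < 1"
  obtains c where "c \<ge> 1" "\<And>z. cmod (f z) \<le> exp (exp (c * (cmod z + 1)))"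
proof (cases "\<exists>w. f w \<noteq> 0")
  case False
  then show ?thesis using that[of 1] by auto
next
  case True
  then obtain w where w: "f w \<noteq> 0" by blast
  have "eventually (\<lambda>r. ereal (ln (ln (nev_T_entire f r)) / ln r) < 1) at_top"
    using ho unfolding hyper_order_entire_def by (rule Limsup_lessD)
  then obtain r0 where r0: "\<And>r. r \<ge> r0 \<Longrightarrow> ereal (ln (ln (nev_T_entire f r)) / ln r) < 1"
    by (auto simp: eventually_at_top_linorder)
  have T: "nev_T_entire f r \<le> exp r" if "r \<ge> max r0 3" for r
  \<comment> \<open>For T > e both iterated logarithms are positive and can be undone. Smaller T,
    for which ln (ln T) may be a mere default value, satisfy the bound because r >= 3.\<close>
  proof (cases "nev_T_entire f r \<le> exp 1")
    case True
    also have "exp 1 \<le> exp r" using that by simp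
    finally show ?thesis .
  next
    case False
    define T where "T = nev_T_entire f r"
    have Te: "T > exp 1" using False by (simp add: T_def)
    then have "ln T > 1" using less_trans[OF exp_gt_zero Te] by (metis exp_gt_zero ln_exp ln_less_cancel_iff)
    have "ln r > 0" using that by simp
    have "ln (ln T) / ln r < 1" using r0[of r] that by (simp add: T_def one_ereal_def)
    then have "ln (ln T) < ln r" using \<open>ln r > 0\<close> by simp
    then have "ln T < r" using \<open>ln T > 1\<close> that by (subst (asm) ln_less_cancel_iff) auto
    then have "T < exp r" using Te less_trans[OF exp_gt_zero Te] by (metis exp_less_cancel_iff exp_ln)
    then show ?thesis by (simp add: T_def)
  qed
  define q where "q = max r0 3"
  define c where "c = q + 4"
  have q3: "q \<ge> 3" by (simp add: q_def)
  show ?thesis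
  proof (rule that[of c])
    show "c \<ge> 1" using q3 by (simp add: c_def)
    fix z
    show "cmod (f z) \<le> exp (exp (c * (cmod z + 1)))"
    proof (cases "f z = 0")
      case False
      define s where "s = 2 * cmod z + q"
      define Y where "Y = cmod ` {x. cmod x \<le> s + 1 \<and> f x = 0}"
      have "finite Y" unfolding Y_def using finite_zeros_cball[OF f w] by auto
      then obtain r where r: "s \<le> r" "r \<le> s + 1" "r \<notin> Y"
        using ex_real_avoiding[of "{}" Y s "s + 1"] by auto
      have s: "s \<ge> 2 * cmod z" "s \<ge> q" using q3 by (auto simp: s_def)
      have nzr: "f x \<noteq> 0" if "cmod x = r" for x using r that by (auto simp: Y_def)
      have "ln (cmod (f z)) \<le> 3 * nev_T_entire f r"
        by (rule ln_le_3_nev_T[OF f nzr _ _ False]) (use r s q3 in auto)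
      also have "\<dots> \<le> 3 * exp r" using T[of r] r(1) s(2) by (simp add: q_def)
      also have "\<dots> \<le> exp 2 * exp r"
        using exp_ge_add_one_self[of 2] by (intro mult_right_mono) auto
      also have "\<dots> = exp (2 + r)" by (simp add: exp_add)
      also have "2 + r \<le> c * (cmod z + 1)"
      proof -
        have "2 + r \<le> 2 * cmod z + q + 3" using r by (simp add: s_def)
        also have "\<dots> \<le> c * (cmod z + 1)"
          using q3 mult_nonneg_nonneg[of "q" "cmod z"] by (simp add: c_def algebra_simps)
        finally show ?thesis .
      qed
      then have "exp (2 + r) \<le> exp (c * (cmod z + 1))" by simp
      finally have "ln (cmod (f z)) \<le> exp (c * (cmod z + 1))" .
      then show ?thesis using False by (metis exp_le_cancel_iff exp_ln zero_less_norm_iff)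
    qed auto
  qed
qed

section \<open>Interpolation and local expansions\<close>

lemma degree_prod_linear:
  "finite S \<Longrightarrow> degree (\<Prod>a\<in>S. [:-a, 1:] :: complex poly) = card S"
  by (subst degree_prod_eq_sum_degree) auto

text \<open>Partial fractions: P/Q is a combination of the 1/(w - a), so d P(w)/Q(w) is controlled
  by the quotients d/(w - a). For w = f(z) and d = f'(z) these are the logarithmic derivatives of f
  - a.\<close>

lemma Lagrange_interpolation_bound:
  fixes P :: "complex poly"
  assumes S: "finite S" and deg: "degree P < card S"
  obtains C where "C \<ge> 0" "\<And>w d \<Lambda>. (\<And>a. a \<in> S \<Longrightarrow> cmod d \<le> \<Lambda> * cmod (w - a)) \<Longrightarrow>
     cmod d * cmod (poly P w) \<le> C * \<Lambda> * cmod (poly (\<Prod>a\<in>S. [:-a, 1:]) w)"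
proof -
  define q where "q = (\<lambda>a. (\<Prod>b\<in>S - {a}. [:-b, 1:] :: complex poly))"
  define c where "c = (\<lambda>a. poly P a / poly (q a) a)"
  have q0: "poly (q a) b = 0" if "a \<in> S" "b \<in> S" "a \<noteq> b" for a b
    using that S by (auto simp: q_def poly_prod)
  have qa: "poly (q a) a \<noteq> 0" for a
    using S by (auto simp: q_def poly_prod)
  have "P = (\<Sum>a\<in>S. smult (c a) (q a))"
  proof (rule poly_eqI_degree[of S])
    fix x assume x: "x \<in> S"
    have "poly (\<Sum>a\<in>S. smult (c a) (q a)) x = (\<Sum>a\<in>S. if a = x then c x * poly (q x) x else 0)"
      unfolding poly_sum using q0 x by (intro sum.cong) auto
    also have "\<dots> = poly P x" using S x qa by (simp add: c_def)
    finally show "poly P x = poly (\<Sum>a\<in>S. smult (c a) (q a)) x" by simp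
  next
    show "degree P < card S" by fact
    have "degree (smult (c a) (q a)) \<le> card S - 1" if "a \<in> S" for a
      using degree_smult_le[of "c a" "q a"] degree_prod_linear[of "S - {a}"] S that
      by (simp add: q_def)
    then have "degree (\<Sum>a\<in>S. smult (c a) (q a)) \<le> card S - 1" by (intro degree_sum_le S)
    then show "degree (\<Sum>a\<in>S. smult (c a) (q a)) < card S" using deg by linarith
  qed
  then have P: "poly P w = (\<Sum>a\<in>S. c a * poly (q a) w)" for w
    by (metis (no_types, lifting) poly_smult poly_sum sum.cong)
  have Q: "poly (\<Prod>a\<in>S. [:-a, 1:]) w = (w - a) * poly (q a) w" if "a \<in> S" for a w
    using S that by (subst prod.remove[of S a]) (auto simp: q_def algebra_simps)
  show ?thesis
  proof (rule that[of "\<Sum>a\<in>S. cmod (c a)"])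
    fix w d \<Lambda> assume d: "\<And>a. a \<in> S \<Longrightarrow> cmod d \<le> \<Lambda> * cmod (w - a)"
    have "cmod d * cmod (poly P w) \<le> cmod d * (\<Sum>a\<in>S. cmod (c a * poly (q a) w))"
      unfolding P by (intro mult_left_mono norm_sum) auto
    also have "\<dots> = (\<Sum>a\<in>S. cmod d * (cmod (c a) * cmod (poly (q a) w)))"
      by (simp add: sum_distrib_left norm_mult)
    also have "\<dots> \<le> (\<Sum>a\<in>S. (\<Lambda> * cmod (w - a)) * (cmod (c a) * cmod (poly (q a) w)))"
      by (intro sum_mono mult_right_mono d) auto
    also have "\<dots> = (\<Sum>a\<in>S. cmod (c a) * (\<Lambda> * cmod (poly (\<Prod>a\<in>S. [:-a, 1:]) w)))"
      using Q by (intro sum.cong) (auto simp: norm_mult mult_ac)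
    also have "\<dots> = (\<Sum>a\<in>S. cmod (c a)) * \<Lambda> * cmod (poly (\<Prod>a\<in>S. [:-a, 1:]) w)"
      by (simp add: sum_distrib_right sum_distrib_left mult_ac)
    finally show "cmod d * cmod (poly P w) \<le> (\<Sum>a\<in>S. cmod (c a)) * \<Lambda> * cmod (poly (\<Prod>a\<in>S. [:-a, 1:]) w)" .
  qed (auto intro: sum_nonneg)
qed

text \<open>One factor d is paid for by w - a1, the other by interpolation of (w - a1) D^2 and w (w
  - a1) D^2; the second polynomial accounts for the |w| in 1 + |w|. Their degrees are at most 2 deg
  D + 2, which is where the size of \<open>S\<close> enters.\<close>

lemma squared_factor_bound:
  fixes D :: "complex poly"
  assumes S: "finite S" and deg: "2 * degree D + 2 < card S"
  obtains C where "C \<ge> 0" "\<And>w d \<Lambda>. \<Lambda> \<ge> 0 \<Longrightarrow> (\<And>a. a \<in> S \<Longrightarrow> cmod d \<le> \<Lambda> * cmod (w - a)) \<Longrightarrow>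
     (cmod (d * poly D w))\<^sup>2 * (1 + cmod w) \<le> C * \<Lambda>\<^sup>2 * cmod (poly (\<Prod>a\<in>S. [:-a, 1:]) w)"
proof -
  have "S \<noteq> {}" using deg by auto
  then obtain a1 where a1: "a1 \<in> S" by auto
  define P1 where "P1 = [:-a1, 1:] * (D * D)"
  define P2 where "P2 = [:0, 1:] * P1"
  have "degree P1 \<le> 1 + (degree D + degree D)"
    unfolding P1_def by (rule order_trans[OF degree_mult_le add_mono[OF _ degree_mult_le]]) simp
  moreover have "degree P2 \<le> 1 + degree P1"
    unfolding P2_def by (rule order_trans[OF degree_mult_le]) simp
  ultimately have d12: "degree P1 < card S" "degree P2 < card S" using deg by auto
  obtain C1 where C1: "C1 \<ge> 0" "\<And>w d \<Lambda>. (\<And>a. a \<in> S \<Longrightarrow> cmod d \<le> \<Lambda> * cmod (w - a)) \<Longrightarrow>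
     cmod d * cmod (poly P1 w) \<le> C1 * \<Lambda> * cmod (poly (\<Prod>a\<in>S. [:-a, 1:]) w)"
    using Lagrange_interpolation_bound[OF S d12(1)] by blast
  obtain C2 where C2: "C2 \<ge> 0" "\<And>w d \<Lambda>. (\<And>a. a \<in> S \<Longrightarrow> cmod d \<le> \<Lambda> * cmod (w - a)) \<Longrightarrow>
     cmod d * cmod (poly P2 w) \<le> C2 * \<Lambda> * cmod (poly (\<Prod>a\<in>S. [:-a, 1:]) w)"
    using Lagrange_interpolation_bound[OF S d12(2)] by blast
  show ?thesis
  proof (rule that[of "C1 + C2"])
    fix w d \<Lambda> assume L: "\<Lambda> \<ge> 0" and d: "\<And>a. a \<in> S \<Longrightarrow> cmod d \<le> \<Lambda> * cmod (w - a)"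
    let ?Q = "cmod (poly (\<Prod>a\<in>S. [:-a, 1:]) w)"
    have "(cmod (d * poly D w))\<^sup>2 * (1 + cmod w) = cmod d * (cmod d * (cmod (poly D w))\<^sup>2 * (1 + cmod w))"
      by (simp add: norm_mult power2_eq_square mult_ac)
    also have "\<dots> \<le> (\<Lambda> * cmod (w - a1)) * (cmod d * (cmod (poly D w))\<^sup>2 * (1 + cmod w))"
      by (intro mult_right_mono d a1) auto
    also have "\<dots> = \<Lambda> * (cmod d * cmod (poly P1 w) + cmod d * cmod (poly P2 w))"
      by (simp add: P1_def P2_def norm_mult power2_eq_square algebra_simps flip: norm_mult)
    also have "\<dots> \<le> \<Lambda> * (C1 * \<Lambda> * ?Q + C2 * \<Lambda> * ?Q)"
      by (intro mult_left_mono add_mono C1 C2 L d)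
    also have "\<dots> = (C1 + C2) * \<Lambda>\<^sup>2 * ?Q" by (simp add: power2_eq_square algebra_simps)
    finally show "(cmod (d * poly D w))\<^sup>2 * (1 + cmod w) \<le> (C1 + C2) * \<Lambda>\<^sup>2 * ?Q" .
  qed (use C1 C2 in auto)
qed

text \<open>The logarithmic derivative of \<open>(1/F)'\<close>.\<close>

definition log_deriv_inverse' :: "(complex \<Rightarrow> complex) \<Rightarrow> complex \<Rightarrow> complex" where
  "log_deriv_inverse' F w = deriv (deriv F) w / deriv F w - 2 * (deriv F w / F w)"

section \<open>Orders and residues of logarithmic derivatives\<close>

lemma deriv_power_factor:
  assumes h: "\<And>w. w \<in> ball z e \<Longrightarrow> h w = (w - z) ^ m * \<phi> w" and hol: "\<phi> holomorphic_on ball z e"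
    and w: "w \<in> ball z e"
  shows "deriv h w = of_nat m * (w - z) ^ (m - 1) * \<phi> w + (w - z) ^ m * deriv \<phi> w"
proof -
  have "(\<phi> has_field_derivative deriv \<phi> w) (at w)" using hol w holomorphic_derivI by blast
  then have "((\<lambda>w. (w - z) ^ m * \<phi> w) has_field_derivative
      (of_nat m * (w - z) ^ (m - 1) * \<phi> w + (w - z) ^ m * deriv \<phi> w)) (at w)"
    by (auto intro!: derivative_eq_intros)
  then have "(h has_field_derivative
      (of_nat m * (w - z) ^ (m - 1) * \<phi> w + (w - z) ^ m * deriv \<phi> w)) (at w)"
    by (rule has_field_derivative_transform_within_open[OF _ open_ball w]) (simp add: h)
  then show ?thesis by (rule DERIV_imp_deriv)
qed

lemma log_deriv_power_factor:
  assumes h: "\<And>w. w \<in> ball z e \<Longrightarrow> h w = (w - z) ^ m * \<phi> w" and hol: "\<phi> holomorphic_on ball z e"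
    and w: "w \<in> ball z e" "w \<noteq> z" "\<phi> w \<noteq> 0"
  shows "deriv h w / h w = of_nat m / (w - z) + deriv \<phi> w / \<phi> w"
proof -
  have p: "of_nat m * (w - z) ^ (m - 1) * (w - z) = of_nat m * (w - z) ^ m"
    by (cases m) auto
  have "deriv h w = of_nat m * (w - z) ^ (m - 1) * \<phi> w + (w - z) ^ m * deriv \<phi> w"
    by (rule deriv_power_factor[OF h hol w(1)])
  then have "deriv h w * (w - z) = of_nat m * (w - z) ^ (m - 1) * (w - z) * \<phi> w + (w - z) ^ m * deriv \<phi> w * (w - z)"
    by (simp only: distrib_right distrib_left mult_ac)
  then have "deriv h w * (w - z) = (w - z) ^ m * (of_nat m * \<phi> w + (w - z) * deriv \<phi> w)"
    unfolding p by (simp only: distrib_left mult_ac)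
  moreover have "(of_nat m / (w - z) + deriv \<phi> w / \<phi> w) * h w * (w - z) =
      (w - z) ^ m * (of_nat m * \<phi> w + (w - z) * deriv \<phi> w)"
    unfolding h[OF w(1)] using w(2,3) by (simp add: field_simps)
  ultimately have "deriv h w = (of_nat m / (w - z) + deriv \<phi> w / \<phi> w) * h w"
    using w(2) by (metis mult_right_cancel right_minus_eq)
  moreover have "h w \<noteq> 0" unfolding h[OF w(1)] using w by simp
  ultimately show ?thesis by simp
qed

lemma tendsto_holomorphic:
  assumes "\<phi> holomorphic_on ball z e" "e > 0"
  shows "(\<phi> \<longlongrightarrow> \<phi> z) (at z)"
  using assms holomorphic_on_imp_continuous_on continuous_on_eq_continuous_at[OF open_ball]
  by (metis centre_in_ball isContD)

text \<open>At a zero of order m + 1 the residue is m - 2(m + 1) = -(m + 2), determined by the order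
  alone. At a simple zero the constant term vanishes as well: F' = \<psi> = \<phi> + (w - z)\<phi>',
  hence \<psi>'(z) = 2\<phi>'(z) and \<psi>(z) = \<phi>(z). This makes the difference of two such
  expressions vanish at a common simple zero.\<close>

lemma log_deriv_inverse'_at_zero:
  assumes F: "\<And>w. w \<in> ball z e \<Longrightarrow> F w = (w - z) ^ Suc m * \<phi> w" and hol: "\<phi> holomorphic_on ball z e"
    and e: "e > 0" and nz: "\<phi> z \<noteq> 0"
  obtains l3 l4 where
    "((\<lambda>w. log_deriv_inverse' F w + of_nat (m + 2) / (w - z)) \<longlongrightarrow> l3) (at z)"
    "m = 0 \<Longrightarrow> ((\<lambda>w. (log_deriv_inverse' F w + of_nat (m + 2) / (w - z)) / (w - z)) \<longlongrightarrow> l4) (at z)"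
proof -
  define \<psi> where "\<psi> = (\<lambda>w. of_nat (m + 1) * \<phi> w + (w - z) * deriv \<phi> w)"
  have hd: "deriv \<phi> holomorphic_on ball z e" "deriv (deriv \<phi>) holomorphic_on ball z e"
    by (auto intro!: holomorphic_deriv hol)
  have hpsi: "\<psi> holomorphic_on ball z e" unfolding \<psi>_def by (intro holomorphic_intros hol hd)
  have hdpsi: "deriv \<psi> holomorphic_on ball z e" by (auto intro!: holomorphic_deriv hpsi)
  have F': "deriv F w = (w - z) ^ m * \<psi> w" if "w \<in> ball z e" for w
  proof -
    have "deriv F w = of_nat (Suc m) * (w - z) ^ (Suc m - 1) * \<phi> w + (w - z) ^ Suc m * deriv \<phi> w"
      by (rule deriv_power_factor[OF F hol that])
    then show ?thesis unfolding \<psi>_def by (simp add: algebra_simps)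
  qed
  have lim: "(\<phi> \<longlongrightarrow> \<phi> z) (at z)" "(deriv \<phi> \<longlongrightarrow> deriv \<phi> z) (at z)" "(\<psi> \<longlongrightarrow> \<psi> z) (at z)"
     "(deriv (deriv \<phi>) \<longlongrightarrow> deriv (deriv \<phi>) z) (at z)"  "(deriv \<psi> \<longlongrightarrow> deriv \<psi> z) (at z)"
    by (intro tendsto_holomorphic[OF _ e] hol hd hpsi hdpsi)+
  have psiz: "\<psi> z \<noteq> 0" using nz by (simp add: \<psi>_def flip: of_nat_Suc)
  have "eventually (\<lambda>w. \<phi> w \<noteq> 0) (at z)" "eventually (\<lambda>w. \<psi> w \<noteq> 0) (at z)"
    using tendsto_imp_eventually_ne[OF lim(1) nz] tendsto_imp_eventually_ne[OF lim(3) psiz] by auto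
  moreover have "eventually (\<lambda>w. w \<in> ball z e - {z}) (at z)" using e by (intro eventually_at_in_open) auto
  ultimately have ev: "eventually (\<lambda>w. \<phi> w \<noteq> 0 \<and> \<psi> w \<noteq> 0 \<and> w \<in> ball z e \<and> w \<noteq> z) (at z)"
    by eventually_elim auto
  have eq: "log_deriv_inverse' F w + of_nat (m + 2) / (w - z) = deriv \<psi> w / \<psi> w - 2 * (deriv \<phi> w / \<phi> w)"
    if w: "\<phi> w \<noteq> 0 \<and> \<psi> w \<noteq> 0 \<and> w \<in> ball z e \<and> w \<noteq> z" for w
  proof -
    have "deriv F w / F w = of_nat (Suc m) / (w - z) + deriv \<phi> w / \<phi> w"
      by (rule log_deriv_power_factor[OF F hol]) (use w in auto)
    moreover have "deriv (deriv F) w / deriv F w = of_nat m / (w - z) + deriv \<psi> w / \<psi> w"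
      by (rule log_deriv_power_factor[OF F' hpsi]) (use w in auto)
    moreover have "of_nat m / (w - z) - 2 * (of_nat (Suc m) / (w - z)) + of_nat (m + 2) / (w - z) = 0"
    proof -
      have *: "a / t - 2 * (b / t) + c / t = (a - 2 * b + c) / t" for a b c t :: complex
        by (simp add: diff_divide_distrib add_divide_distrib)
      show ?thesis unfolding * by simp
    qed
    ultimately show ?thesis unfolding log_deriv_inverse'_def by (simp add: algebra_simps)
  qed
  show ?thesis
  proof (rule that)
    have "((\<lambda>w. deriv \<psi> w / \<psi> w - 2 * (deriv \<phi> w / \<phi> w)) \<longlongrightarrow> deriv \<psi> z / \<psi> z - 2 * (deriv \<phi> z / \<phi> z)) (at z)"
      by (intro tendsto_intros lim nz psiz)
    then show "((\<lambda>w. log_deriv_inverse' F w + of_nat (m + 2) / (w - z)) \<longlongrightarrow> deriv \<psi> z / \<psi> z - 2 * (deriv \<phi> z / \<phi> z)) (at z)"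
      by (rule Lim_transform_eventually) (use ev in eventually_elim, use eq in auto)
    assume m: "m = 0"
    have dpsi: "deriv \<psi> w = 2 * deriv \<phi> w + (w - z) * deriv (deriv \<phi>) w" if w: "w \<in> ball z e" for w
    proof -
      have "(\<phi> has_field_derivative deriv \<phi> w) (at w)" "(deriv \<phi> has_field_derivative deriv (deriv \<phi>) w) (at w)"
        using hol hd(1) w holomorphic_derivI by blast+
      then have "(\<psi> has_field_derivative 2 * deriv \<phi> w + (w - z) * deriv (deriv \<phi>) w) (at w)"
        unfolding \<psi>_def using m by (auto intro!: derivative_eq_intros)
      then show ?thesis by (rule DERIV_imp_deriv)
    qed
    \<comment> \<open>This is \<psi>'/\<psi> - 2\<phi>'/\<phi> over the common denominator and
      divided by w - z; the terms 2\<phi>\<phi>' have cancelled.\<close>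
    have "((\<lambda>w. (\<phi> w * deriv (deriv \<phi>) w - 2 * (deriv \<phi> w)\<^sup>2) / (\<phi> w * \<psi> w)) \<longlongrightarrow>
       (\<phi> z * deriv (deriv \<phi>) z - 2 * (deriv \<phi> z)\<^sup>2) / (\<phi> z * \<psi> z)) (at z)"
      by (intro tendsto_intros lim) (use nz psiz in auto)
    then show "((\<lambda>w. (log_deriv_inverse' F w + of_nat (m + 2) / (w - z)) / (w - z)) \<longlongrightarrow> 
       (\<phi> z * deriv (deriv \<phi>) z - 2 * (deriv \<phi> z)\<^sup>2) / (\<phi> z * \<psi> z)) (at z)"
    proof (rule Lim_transform_eventually)
      show "eventually (\<lambda>w. (\<phi> w * deriv (deriv \<phi>) w - 2 * (deriv \<phi> w)\<^sup>2) / (\<phi> w * \<psi> w) =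
         (log_deriv_inverse' F w + of_nat (m + 2) / (w - z)) / (w - z)) (at z)"
        using ev
      proof eventually_elim
        case (elim w)
        have "\<psi> w = \<phi> w + (w - z) * deriv \<phi> w" using m by (simp add: \<psi>_def)
        then have "deriv \<psi> w / \<psi> w - 2 * (deriv \<phi> w / \<phi> w) =
          (w - z) * (\<phi> w * deriv (deriv \<phi>) w - 2 * (deriv \<phi> w)\<^sup>2) / (\<phi> w * \<psi> w)"
          using dpsi[of w] elim by (simp add: divide_simps) (simp add: algebra_simps power2_eq_square)
        then show ?case unfolding eq[OF elim] using elim by simp
      qed
    qed
  qed
qed

lemma entire_power_factor:
  assumes f: "f holomorphic_on UNIV" "f w0 \<noteq> 0"
  obtains \<phi> e where "e > 0" "\<phi> holomorphic_on ball z e" "\<phi> z \<noteq> 0"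
     "\<And>w. w \<in> ball z e \<Longrightarrow> f w = (w - z) ^ nat (zorder f z) * \<phi> w"
     "f z = 0 \<longleftrightarrow> nat (zorder f z) > 0"
proof -
  have "(if f z=0 then zorder f z > 0 else zorder f z = 0) \<and> (\<exists>r. r>0 \<and> cball z r \<subseteq> UNIV \<and> zor_poly f z holomorphic_on cball z r
    \<and> (\<forall>w\<in>cball z r. f w  = zor_poly f z w * (w-z) ^ nat (zorder f z)  \<and> zor_poly f z w \<noteq>0))"
    by (rule zorder_exist_zero[OF f(1)]) (use f in auto)
  then obtain r where r: "r>0" "zor_poly f z holomorphic_on cball z r"
    "\<And>w. w\<in>cball z r \<Longrightarrow> f w  = zor_poly f z w * (w-z) ^ nat (zorder f z)  \<and> zor_poly f z w \<noteq>0"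
    "if f z=0 then zorder f z > 0 else zorder f z = 0" by blast
  show ?thesis
    by (rule that[of r "zor_poly f z"])
       (use r holomorphic_on_subset[OF r(2) ball_subset_cball] in \<open>auto split: if_splits simp: mult.commute\<close>)
qed

lemma eventually_entire_nonzero:
  assumes "h holomorphic_on UNIV" "h w0 \<noteq> 0"
  shows "eventually (\<lambda>w. h w \<noteq> 0) (at z)"
  using non_zero_neighbour_alt[OF assms(1), of z w0] assms(2) by auto

lemma eventually_entire_neq:
  fixes f :: "complex \<Rightarrow> complex"
  assumes "f holomorphic_on UNIV" "\<not> (\<exists>c. \<forall>z. f z = c)"
  shows "eventually (\<lambda>w. f w \<noteq> a) (at z)"
proof -
  obtain w0 where "f w0 - a \<noteq> 0" using assms(2) by (metis right_minus_eq)
  moreover have "(\<lambda>w. f w - a) holomorphic_on UNIV" by (intro holomorphic_intros assms)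
  ultimately show ?thesis using eventually_entire_nonzero[of "\<lambda>w. f w - a" w0 z] by simp
qed

lemma eventually_poly_entire_nonzero:
  fixes f :: "complex \<Rightarrow> complex"
  assumes f: "f holomorphic_on UNIV" "\<not> (\<exists>c. \<forall>z. f z = c)" and P: "P \<noteq> 0"
  shows "eventually (\<lambda>w. poly P (f w) \<noteq> 0) (at z)"
proof -
  have "eventually (\<lambda>w. \<forall>r\<in>{x. poly P x = 0}. f w \<noteq> r) (at z)"
    by (rule eventually_ball_finite[OF poly_roots_finite[OF P]]) (use eventually_entire_neq[OF f] in auto)
  then show ?thesis by eventually_elim auto
qed

lemma eventually_deriv_entire_nonzero:
  fixes f :: "complex \<Rightarrow> complex"
  assumes f: "f holomorphic_on UNIV" "\<not> (\<exists>c. \<forall>z. f z = c)"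
  shows "eventually (\<lambda>w. deriv f w \<noteq> 0) (at z)"
proof -
  have "\<exists>w0. deriv f w0 \<noteq> 0"
  proof (rule ccontr)
    assume "\<not> ?thesis"
    then have "\<And>x. x \<in> UNIV \<Longrightarrow> (f has_field_derivative 0) (at x within UNIV)"
      using holomorphic_derivI[OF f(1)] by (metis UNIV_I open_UNIV)
    then have "\<exists>c. \<forall>x\<in>UNIV. f x = c"
      by (metis has_field_derivative_zero_constant[of UNIV f] convex_UNIV UNIV_I)
    then show False using f(2) by auto
  qed
  moreover have "deriv f holomorphic_on UNIV" by (intro holomorphic_deriv f) auto
  ultimately show ?thesis using eventually_entire_nonzero by blast
qed

lemma holomorphic_on_poly_compose [holomorphic_intros]:
  "f holomorphic_on A \<Longrightarrow> (\<lambda>z. poly P (f z)) holomorphic_on A"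
  by (induction P) (auto intro!: holomorphic_intros)

lemma deriv_poly_compose:
  fixes f :: "complex \<Rightarrow> complex"
  assumes "f holomorphic_on UNIV"
  shows "deriv (\<lambda>z. poly P (f z)) = (\<lambda>z. poly (pderiv P) (f z) * deriv f z)"
proof
  fix z
  have "(f has_field_derivative deriv f z) (at z)" using assms holomorphic_derivI by blast
  then have "((\<lambda>z. poly P (f z)) has_field_derivative (poly (pderiv P) (f z) * deriv f z)) (at z)"
    by (rule DERIV_chain2[OF poly_DERIV])
  then show "deriv (\<lambda>z. poly P (f z)) z = poly (pderiv P) (f z) * deriv f z" by (rule DERIV_imp_deriv)
qed

text \<open>The roots of the polynomial are simple, so \<open>F\<close> vanishes at z exactly to the
  order p = m + 1 of f - f(z), while f' D(f) vanishes at least to order m. Only \<open>l1\<close>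
  has to be nonzero, because \<open>F\<close> will stand in a denominator; the other limits record
  lower bounds for orders.\<close>

lemma local_orders_at_shared_zero:
  fixes f :: "complex \<Rightarrow> complex" and D :: "complex poly"
  assumes f: "f holomorphic_on UNIV" "\<not> (\<exists>c. \<forall>z. f z = c)" and S: "finite S" "f z \<in> S"
    and p: "p = nat (zorder (\<lambda>w. f w - f z) z)"
    and F: "F = (\<lambda>w. poly (\<Prod>a\<in>S. [:-a, 1:]) (f w))"
  obtains m l1 l2 l3 l4 where "p = Suc m" "l1 \<noteq> 0"
    "((\<lambda>w. F w / (w - z) ^ Suc m) \<longlongrightarrow> l1) (at z)"
    "((\<lambda>w. deriv f w * poly D (f w) / (w - z) ^ m) \<longlongrightarrow> l2) (at z)"
    "((\<lambda>w. log_deriv_inverse' F w + of_nat (m + 2) / (w - z)) \<longlongrightarrow> l3) (at z)"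
    "m = 0 \<Longrightarrow> ((\<lambda>w. (log_deriv_inverse' F w + of_nat (m + 2) / (w - z)) / (w - z)) \<longlongrightarrow> l4) (at z)"
proof -
  obtain w0 where w0: "f w0 - f z \<noteq> 0" using f(2) by (metis right_minus_eq)
  have hol: "(\<lambda>w. f w - f z) holomorphic_on UNIV" by (intro holomorphic_intros f)
  obtain u e where u: "e > 0" "u holomorphic_on ball z e" "u z \<noteq> 0"
     "\<And>w. w \<in> ball z e \<Longrightarrow> f w - f z = (w - z) ^ p * u w" "p > 0"
  proof (rule entire_power_factor[OF hol w0, of z, folded p])
    fix u e assume u: "e > 0" "u holomorphic_on ball z e" "u z \<noteq> 0"
     "\<And>w. w \<in> ball z e \<Longrightarrow> f w - f z = (w - z) ^ p * u w" "f z - f z = 0 \<longleftrightarrow> p > 0"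
    show thesis by (rule that[OF u(1-4)]) (use u(5) in simp_all)
  qed
  obtain m where m: "p = Suc m" using u(5) by (cases p) auto
  define q where "q = (\<Prod>b\<in>S - {f z}. [:-b, 1:] :: complex poly)"
  have Qe: "(\<Prod>a\<in>S. [:-a, 1:]) = [:-(f z), 1:] * q" unfolding q_def by (rule prod.remove) (use S in auto)
  have qz: "poly q (f z) \<noteq> 0" using S by (auto simp: q_def poly_prod)
  define \<phi> where "\<phi> = (\<lambda>w. u w * poly q (f w))"
  have f': "f holomorphic_on ball z e" by (rule holomorphic_on_subset[OF f(1)]) auto
  have phi: "\<phi> holomorphic_on ball z e" "\<phi> z \<noteq> 0"
    unfolding \<phi>_def using u qz by (auto intro!: holomorphic_intros f')
  have Fw: "F w = (w - z) ^ Suc m * \<phi> w" if "w \<in> ball z e" for w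
  proof -
    have "F w = (f w - f z) * poly q (f w)" unfolding F Qe by (simp add: algebra_simps)
    then show ?thesis unfolding u(4)[OF that] m \<phi>_def by (simp only: mult_ac)
  qed
  have fd: "deriv f w = (w - z) ^ m * (of_nat p * u w + (w - z) * deriv u w)" if "w \<in> ball z e" for w
  proof -
    have "deriv (\<lambda>w. f w - f z) w = deriv f w"
      using f(1) by (subst deriv_diff) (auto simp: holomorphic_on_imp_differentiable_at)
    moreover have "deriv (\<lambda>w. f w - f z) w = of_nat p * (w - z) ^ (p - 1) * u w + (w - z) ^ p * deriv u w"
      by (rule deriv_power_factor[OF u(4) u(2) that])
    ultimately show ?thesis unfolding m by (simp add: algebra_simps)
  qed
  have ev: "eventually (\<lambda>w. w \<in> ball z e - {z}) (at z)" using u(1) by (intro eventually_at_in_open) auto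
  obtain l3 l4 where l34:
    "((\<lambda>w. log_deriv_inverse' F w + of_nat (m + 2) / (w - z)) \<longlongrightarrow> l3) (at z)"
    "m = 0 \<Longrightarrow> ((\<lambda>w. (log_deriv_inverse' F w + of_nat (m + 2) / (w - z)) / (w - z)) \<longlongrightarrow> l4) (at z)"
    using log_deriv_inverse'_at_zero[OF Fw phi(1) u(1) phi(2)] by blast
  show ?thesis
  proof (rule that[OF m phi(2) _ _ l34])
    show "((\<lambda>w. F w / (w - z) ^ Suc m) \<longlongrightarrow> \<phi> z) (at z)"
      by (rule Lim_transform_eventually[OF tendsto_holomorphic[OF phi(1) u(1)]])
         (use ev in eventually_elim, use Fw in auto)
    define a where "a = (\<lambda>w. (of_nat p * u w + (w - z) * deriv u w) * poly D (f w))"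
    have "a holomorphic_on ball z e" unfolding a_def
      by (intro holomorphic_intros u f' holomorphic_deriv) auto
    then show "((\<lambda>w. deriv f w * poly D (f w) / (w - z) ^ m) \<longlongrightarrow> a z) (at z)"
      by (rule Lim_transform_eventually[OF tendsto_holomorphic[OF _ u(1)]])
         (use ev in eventually_elim, use fd in \<open>auto simp: a_def\<close>)
  qed
qed

text \<open>Where \<open>F\<close> does not vanish the only possible singularity is the simple pole
  of F''/F' at a zero of F' = Q'(f) f'. There f' or D(f) vanishes, and the factor f' D(f) cancels
  the pole whatever its residue.\<close>

lemma local_limit_off_shared_zero:
  fixes f :: "complex \<Rightarrow> complex" and D Q :: "complex poly"
  assumes f: "f holomorphic_on UNIV" "\<not> (\<exists>c. \<forall>z. f z = c)"
    and Q: "pderiv Q \<noteq> 0" "poly Q (f z) \<noteq> 0" and D: "\<And>d. poly (pderiv Q) d = 0 \<Longrightarrow> poly D d = 0"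
    and F: "F = (\<lambda>w. poly Q (f w))"
  obtains l where "((\<lambda>w. deriv f w * poly D (f w) * log_deriv_inverse' F w) \<longlongrightarrow> l) (at z)"
proof -
  have hF: "F holomorphic_on UNIV" unfolding F by (intro holomorphic_intros f)
  have hF': "deriv F holomorphic_on UNIV" by (intro holomorphic_deriv hF) auto
  define a where "a = (\<lambda>w. deriv f w * poly D (f w))"
  have ha: "a holomorphic_on UNIV" unfolding a_def by (intro holomorphic_intros f holomorphic_deriv) auto
  have F': "deriv F = (\<lambda>w. poly (pderiv Q) (f w) * deriv f w)" unfolding F by (rule deriv_poly_compose[OF f(1)])
  have "eventually (\<lambda>w. deriv F w \<noteq> 0) (at z)"
    using eventually_poly_entire_nonzero[OF f Q(1), of z] eventually_deriv_entire_nonzero[OF f, of z]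
    by eventually_elim (simp add: F')
  then obtain w0 where w0: "deriv F w0 \<noteq> 0" using eventually_happens[of _ "at z"] by (auto simp: trivial_limit_at)
  define m where "m = nat (zorder (deriv F) z)"
  obtain \<psi> e where psi: "e > 0" "\<psi> holomorphic_on ball z e" "\<psi> z \<noteq> 0"
     "\<And>w. w \<in> ball z e \<Longrightarrow> deriv F w = (w - z) ^ m * \<psi> w" "deriv F z = 0 \<longleftrightarrow> m > 0"
    using entire_power_factor[OF hF' w0, of z] unfolding m_def by blast
  have hdpsi: "deriv \<psi> holomorphic_on ball z e" by (intro holomorphic_deriv psi) auto
  have lim: "(\<psi> \<longlongrightarrow> \<psi> z) (at z)" "(deriv \<psi> \<longlongrightarrow> deriv \<psi> z) (at z)" "(a \<longlongrightarrow> a z) (at z)"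
     "(F \<longlongrightarrow> F z) (at z)" "(deriv F \<longlongrightarrow> deriv F z) (at z)"
    using tendsto_holomorphic[OF psi(2,1)] tendsto_holomorphic[OF hdpsi psi(1)]
      tendsto_holomorphic[OF holomorphic_on_subset[OF ha subset_UNIV] psi(1)]
      tendsto_holomorphic[OF holomorphic_on_subset[OF hF subset_UNIV] psi(1)]
      tendsto_holomorphic[OF holomorphic_on_subset[OF hF' subset_UNIV] psi(1)] by blast+
  have Fz: "F z \<noteq> 0" using Q by (simp add: F)
  have "\<exists>b. ((\<lambda>w. a w * (of_nat m / (w - z))) \<longlongrightarrow> b) (at z)"
  proof (cases "m = 0")
    case False
    then have "deriv F z = 0" using psi(5) by simp
    then have az: "a z = 0" using D by (auto simp: F' a_def)
    have "(a has_field_derivative deriv a z) (at z)" using ha holomorphic_derivI by blast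
    then have "((\<lambda>w. (a w - a z) / (w - z)) \<longlongrightarrow> deriv a z) (at z)" by (simp add: has_field_derivative_iff)
    then have "((\<lambda>w. of_nat m * ((a w - a z) / (w - z))) \<longlongrightarrow> of_nat m * deriv a z) (at z)"
      by (intro tendsto_intros)
    then show ?thesis using az by (auto simp: mult_ac)
  qed auto
  then obtain b where b: "((\<lambda>w. a w * (of_nat m / (w - z))) \<longlongrightarrow> b) (at z)" by blast
  have lim2: "((\<lambda>w. a w * (of_nat m / (w - z)) + a w * (deriv \<psi> w / \<psi> w) - a w * (2 * (deriv F w / F w)))
     \<longlongrightarrow> b + a z * (deriv \<psi> z / \<psi> z) - a z * (2 * (deriv F z / F z))) (at z)"
    by (intro tendsto_intros lim b psi Fz)
  have "eventually (\<lambda>w. w \<in> ball z e - {z}) (at z)" using psi(1) by (intro eventually_at_in_open) auto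
  moreover have "eventually (\<lambda>w. \<psi> w \<noteq> 0) (at z)" using tendsto_imp_eventually_ne[OF lim(1) psi(3)] .
  ultimately have ev: "eventually (\<lambda>w. a w * (of_nat m / (w - z)) + a w * (deriv \<psi> w / \<psi> w) - a w * (2 * (deriv F w / F w))
     = a w * log_deriv_inverse' F w) (at z)"
  proof eventually_elim
    case (elim w)
    have "deriv (deriv F) w / deriv F w = of_nat m / (w - z) + deriv \<psi> w / \<psi> w"
      by (rule log_deriv_power_factor[OF psi(4) psi(2)]) (use elim in auto)
    then show ?case unfolding log_deriv_inverse'_def by (simp only: distrib_left right_diff_distrib)
  qed
  show ?thesis
    by (rule that[OF Lim_transform_eventually[OF lim2 ev, unfolded a_def]])
qed

section \<open>Functions sharing the zeros of a polynomial\<close>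

text \<open>The hypotheses are symmetric in f and g, so each local statement is applied to both.
  \<open>D\<close> is kept general: it vanishes at the critical points of the polynomial with root
  set \<open>S\<close>, and its degree leaves room for the interpolation bound.\<close>

locale shared_zeros =
  fixes S :: "complex set" and D :: "complex poly" and f g :: "complex \<Rightarrow> complex"
  assumes S: "finite S"
    and f: "f holomorphic_on UNIV" "\<not> (\<exists>c. \<forall>z. f z = c)"
    and g: "g holomorphic_on UNIV" "\<not> (\<exists>c. \<forall>z. g z = c)"
    and D: "\<And>d. poly (pderiv (\<Prod>a\<in>S. [:-a, 1:])) d = 0 \<Longrightarrow> poly D d = 0"
    and deg: "2 * degree D + 2 < card S"
    and share: "share_set_weight f g S 2"
begin

definition Q :: "complex poly" where "Q = (\<Prod>a\<in>S. [:-a, 1:])"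
definition F :: "complex \<Rightarrow> complex" where "F = (\<lambda>w. poly Q (f w))"
definition G :: "complex \<Rightarrow> complex" where "G = (\<lambda>w. poly Q (g w))"
definition H :: "complex \<Rightarrow> complex" where "H = (\<lambda>w. log_deriv_inverse' F w - log_deriv_inverse' G w)"
text \<open>At zeros of \<open>F\<close>, \<open>G\<close> and their derivatives the value comes
  from division by zero and has no meaning; only the limits of \<open>W0\<close> do, and
  \<open>remove_sings\<close> inserts them.\<close>

definition W0 :: "complex \<Rightarrow> complex" where
  "W0 = (\<lambda>w. (H w)\<^sup>2 * (deriv f w * poly D (f w))\<^sup>2 * (deriv g w * poly D (g w))\<^sup>2 / (F w * G w))"
definition W :: "complex \<Rightarrow> complex" where "W = remove_sings W0"

lemma degQ: "degree Q = card S" unfolding Q_def by (rule degree_prod_linear[OF S])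

lemma Qnz: "Q \<noteq> 0" "pderiv Q \<noteq> 0"
  using degQ deg by (auto simp: pderiv_eq_0_iff)

lemma poly_Q_eq_0: "poly Q x = 0 \<longleftrightarrow> x \<in> S"
  using S by (auto simp: Q_def poly_prod)

lemma DQ: "poly (pderiv Q) d = 0 \<Longrightarrow> poly D d = 0"
  using D by (simp add: Q_def)

lemma hol: "F holomorphic_on UNIV" "G holomorphic_on UNIV" "deriv F holomorphic_on UNIV" "deriv G holomorphic_on UNIV"
  "deriv f holomorphic_on UNIV" "deriv g holomorphic_on UNIV"
proof -
  show *: "F holomorphic_on UNIV" "G holomorphic_on UNIV"
    unfolding F_def G_def by (intro holomorphic_intros f g)+
  show "deriv F holomorphic_on UNIV" "deriv G holomorphic_on UNIV"
    "deriv f holomorphic_on UNIV" "deriv g holomorphic_on UNIV"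
    by (intro holomorphic_deriv * f g open_UNIV)+
qed

lemma E_weighted_eq:
  "E_weighted k S 2 z = (if k z \<in> S then min (nat (zorder (\<lambda>w. k w - k z) z)) 3 else 0)"
proof -
  have "E_weighted k S 2 z = (\<Sum>a\<in>S. if k z = a then min (nat (zorder (\<lambda>w. k w - k z) z)) 3 else 0)"
    unfolding E_weighted_def by (intro sum.cong) auto
  then show ?thesis using S by simp
qed

text \<open>Count orders, with m + 1 and n + 1 those of \<open>F\<close> and \<open>G\<close>: the
  squares of f' D(f) and g' D(g) give at least 2m + 2n, the denominator costs m + n + 2. For m = n =
  0 the deficit 2 is made up by H^2; for m = n > 0 the residues cancel in \<open>H\<close>; for m, n
  >= 2 the surplus m + n - 2 >= 2 covers the double pole of H^2.\<close>

lemma W0_limit_at_zero: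
  assumes fz: "f z \<in> S" and gz: "g z \<in> S"
  obtains l where "(W0 \<longlongrightarrow> l) (at z)"
proof -
  define p where "p = nat (zorder (\<lambda>w. f w - f z) z)"
  define q where "q = nat (zorder (\<lambda>w. g w - g z) z)"
  have pq: "min p 3 = min q 3"
    using share fz gz unfolding share_set_weight_def p_def q_def by (metis E_weighted_eq)
  obtain m l1 l2 l3 l4 where F1: "p = Suc m" "l1 \<noteq> 0"
    "((\<lambda>w. F w / (w - z) ^ Suc m) \<longlongrightarrow> l1) (at z)"
    "((\<lambda>w. deriv f w * poly D (f w) / (w - z) ^ m) \<longlongrightarrow> l2) (at z)"
    "((\<lambda>w. log_deriv_inverse' F w + of_nat (m + 2) / (w - z)) \<longlongrightarrow> l3) (at z)"
    "m = 0 \<Longrightarrow> ((\<lambda>w. (log_deriv_inverse' F w + of_nat (m + 2) / (w - z)) / (w - z)) \<longlongrightarrow> l4) (at z)"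
    by (rule local_orders_at_shared_zero[OF f S fz p_def F_def[unfolded Q_def], where D=D]) (rule that)
  obtain n k1 k2 k3 k4 where G1: "q = Suc n" "k1 \<noteq> 0"
    "((\<lambda>w. G w / (w - z) ^ Suc n) \<longlongrightarrow> k1) (at z)"
    "((\<lambda>w. deriv g w * poly D (g w) / (w - z) ^ n) \<longlongrightarrow> k2) (at z)"
    "((\<lambda>w. log_deriv_inverse' G w + of_nat (n + 2) / (w - z)) \<longlongrightarrow> k3) (at z)"
    "n = 0 \<Longrightarrow> ((\<lambda>w. (log_deriv_inverse' G w + of_nat (n + 2) / (w - z)) / (w - z)) \<longlongrightarrow> k4) (at z)"
    by (rule local_orders_at_shared_zero[OF g S gz q_def G_def[unfolded Q_def], where D=D]) (rule that)
  define a where "a = (\<lambda>w. deriv f w * poly D (f w) / (w - z) ^ m)"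
  define b where "b = (\<lambda>w. deriv g w * poly D (g w) / (w - z) ^ n)"
  define \<phi> where "\<phi> = (\<lambda>w. F w / (w - z) ^ Suc m)"
  define \<gamma> where "\<gamma> = (\<lambda>w. G w / (w - z) ^ Suc n)"
  have lim: "(a \<longlongrightarrow> l2) (at z)" "(b \<longlongrightarrow> k2) (at z)" "(\<phi> \<longlongrightarrow> l1) (at z)" "(\<gamma> \<longlongrightarrow> k1) (at z)"
    using F1(3,4) G1(3,4) by (simp_all add: a_def b_def \<phi>_def \<gamma>_def)
  have limt: "((\<lambda>w. w - z) \<longlongrightarrow> z - z) (at z)" by (intro tendsto_intros)
  have evne: "eventually (\<lambda>w. w \<noteq> z) (at z)" by (rule eventually_neq_at_within)
  have W0e: "W0 w = (H w)\<^sup>2 * (a w * (w - z) ^ m)\<^sup>2 * (b w * (w - z) ^ n)\<^sup>2 / ((\<phi> w * (w - z) ^ Suc m) * (\<gamma> w * (w - z) ^ Suc n))"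
    if "w \<noteq> z" for w
    using that by (simp add: W0_def a_def b_def \<phi>_def \<gamma>_def)
  have ev: "eventually (\<lambda>w. w \<noteq> z \<and> \<phi> w \<noteq> 0 \<and> \<gamma> w \<noteq> 0) (at z)"
    using evne tendsto_imp_eventually_ne[OF lim(3) F1(2)] tendsto_imp_eventually_ne[OF lim(4) G1(2)]
    by eventually_elim auto
  consider "m = 0" "n = 0" | j where "m = Suc j" "n = Suc j" | i j where "m = i + 2" "n = j + 2"
  proof -
    have "m = 0 \<and> n = 0 \<or> (m = 1 \<and> n = 1) \<or> (m \<ge> 2 \<and> n \<ge> 2)"
      using pq F1(1) G1(1) by (auto simp: min_def split: if_splits)
    then show thesis using that by (metis One_nat_def le_add_diff_inverse2)
  qed
  then show ?thesis
  proof cases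
    case 1
    have "((\<lambda>w. ((log_deriv_inverse' F w + of_nat (m + 2) / (w - z)) / (w - z) -
        (log_deriv_inverse' G w + of_nat (n + 2) / (w - z)) / (w - z))\<^sup>2 * (a w)\<^sup>2 * (b w)\<^sup>2 / (\<phi> w * \<gamma> w))
        \<longlongrightarrow> (l4 - k4)\<^sup>2 * l2\<^sup>2 * k2\<^sup>2 / (l1 * k1)) (at z)"
      by (intro tendsto_intros lim F1 G1 1) (use F1 G1 in auto)
    moreover have "eventually (\<lambda>w. ((log_deriv_inverse' F w + of_nat (m + 2) / (w - z)) / (w - z) -
        (log_deriv_inverse' G w + of_nat (n + 2) / (w - z)) / (w - z))\<^sup>2 * (a w)\<^sup>2 * (b w)\<^sup>2 / (\<phi> w * \<gamma> w) = W0 w) (at z)"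
      using ev
    proof eventually_elim
      case (elim w)
      have "(log_deriv_inverse' F w + of_nat (m + 2) / (w - z)) / (w - z) -
        (log_deriv_inverse' G w + of_nat (n + 2) / (w - z)) / (w - z) = H w / (w - z)"
        using 1 by (simp add: H_def diff_divide_distrib add_divide_distrib)
      then show ?case using elim 1 by (simp add: W0e power2_eq_square divide_simps)
    qed
    ultimately show ?thesis by (intro that) (rule Lim_transform_eventually)
  next
    case 2
    have "((\<lambda>w. ((log_deriv_inverse' F w + of_nat (m + 2) / (w - z)) -
        (log_deriv_inverse' G w + of_nat (n + 2) / (w - z)))\<^sup>2 * (a w)\<^sup>2 * (b w)\<^sup>2 * (w - z) ^ (2 * j) / (\<phi> w * \<gamma> w))
        \<longlongrightarrow> (l3 - k3)\<^sup>2 * l2\<^sup>2 * k2\<^sup>2 * (z - z) ^ (2 * j) / (l1 * k1)) (at z)"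
      by (intro tendsto_intros lim F1 G1 limt) (use F1 G1 in auto)
    moreover have "eventually (\<lambda>w. ((log_deriv_inverse' F w + of_nat (m + 2) / (w - z)) -
        (log_deriv_inverse' G w + of_nat (n + 2) / (w - z)))\<^sup>2 * (a w)\<^sup>2 * (b w)\<^sup>2 * (w - z) ^ (2 * j) / (\<phi> w * \<gamma> w) = W0 w) (at z)"
      using ev
    proof eventually_elim
      case (elim w)
      define t where "t = w - z"
      have t: "t \<noteq> 0" using elim by (simp add: t_def)
      have "(log_deriv_inverse' F w + of_nat (m + 2) / (w - z)) -
        (log_deriv_inverse' G w + of_nat (n + 2) / (w - z)) = H w"
        using 2 by (simp add: H_def)
      moreover have "W0 w = (H w)\<^sup>2 * (a w)\<^sup>2 * (b w)\<^sup>2 * t ^ (2 * j) / (\<phi> w * \<gamma> w)"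
        using elim t 2 unfolding W0e[OF conjunct1[OF elim]] t_def[symmetric]
        by (simp add: divide_simps power2_eq_square power_mult power_mult_distrib)
      ultimately show ?case by (simp add: t_def)
    qed
    ultimately show ?thesis by (intro that) (rule Lim_transform_eventually)
  next
    case 3
    \<comment> \<open>\<open>H\<close> may have a simple pole with residue n - m, so (w - z) H is
      used instead. The two powers of w - z that this consumes leave m + n - 4 = i + j.\<close>
    have "((\<lambda>w. ((w - z) * (log_deriv_inverse' F w + of_nat (m + 2) / (w - z)) - (w - z) *
        (log_deriv_inverse' G w + of_nat (n + 2) / (w - z)) + (of_nat n - of_nat m))\<^sup>2 * (a w)\<^sup>2 * (b w)\<^sup>2 * (w - z) ^ (i + j) / (\<phi> w * \<gamma> w))
        \<longlongrightarrow> ((z - z) * l3 - (z - z) * k3 + (of_nat n - of_nat m))\<^sup>2 * l2\<^sup>2 * k2\<^sup>2 * (z - z) ^ (i + j) / (l1 * k1)) (at z)"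
      by (intro tendsto_intros lim F1 G1 limt) (use F1 G1 in auto)
    moreover have "eventually (\<lambda>w. ((w - z) * (log_deriv_inverse' F w + of_nat (m + 2) / (w - z)) - (w - z) *
        (log_deriv_inverse' G w + of_nat (n + 2) / (w - z)) + (of_nat n - of_nat m))\<^sup>2 * (a w)\<^sup>2 * (b w)\<^sup>2 * (w - z) ^ (i + j) / (\<phi> w * \<gamma> w) = W0 w) (at z)"
      using ev
    proof eventually_elim
      case (elim w)
      define t where "t = w - z"
      have t: "t \<noteq> 0" using elim by (simp add: t_def)
      have "t * (log_deriv_inverse' F w + of_nat (m + 2) / t) - t *
        (log_deriv_inverse' G w + of_nat (n + 2) / t) + (of_nat n - of_nat m) = t * H w"
        using t by (simp add: H_def field_simps)
      moreover have "W0 w = (t * H w)\<^sup>2 * (a w)\<^sup>2 * (b w)\<^sup>2 * t ^ (i + j) / (\<phi> w * \<gamma> w)"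
        using elim t 3 unfolding W0e[OF conjunct1[OF elim]] t_def[symmetric]
        by (simp add: divide_simps power2_eq_square power_add)
      ultimately show ?case by (simp add: t_def)
    qed
    ultimately show ?thesis by (intro that) (rule Lim_transform_eventually)
  qed
qed

text \<open>Multiplying \<open>H\<close> by both a = f' D(f) and b = g' D(g) lets each of its two
  terms keep its own cancelling factor, while the remaining factor is entire.\<close>

lemma W0_limit_off_zero:
  assumes fz: "f z \<notin> S" and gz: "g z \<notin> S"
  obtains l where "(W0 \<longlongrightarrow> l) (at z)"
proof -
  define a where "a = (\<lambda>w. deriv f w * poly D (f w))"
  define b where "b = (\<lambda>w. deriv g w * poly D (g w))"
  obtain l1 where l1: "((\<lambda>w. a w * log_deriv_inverse' F w) \<longlongrightarrow> l1) (at z)"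
    unfolding a_def by (rule local_limit_off_shared_zero[OF f Qnz(2) _ DQ F_def]) (use fz poly_Q_eq_0 in auto)
  obtain l2 where l2: "((\<lambda>w. b w * log_deriv_inverse' G w) \<longlongrightarrow> l2) (at z)"
    unfolding b_def by (rule local_limit_off_shared_zero[OF g Qnz(2) _ DQ G_def]) (use gz poly_Q_eq_0 in auto)
  have hab: "a holomorphic_on UNIV" "b holomorphic_on UNIV"
    unfolding a_def b_def by (intro holomorphic_intros hol f g)+
  have t: "(k \<longlongrightarrow> k z) (at z)" if "k holomorphic_on UNIV" for k
    using tendsto_holomorphic[OF holomorphic_on_subset[OF that subset_UNIV], of 1 z] by simp
  have nz: "F z \<noteq> 0" "G z \<noteq> 0" using fz gz poly_Q_eq_0 by (auto simp: F_def G_def)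
  have "((\<lambda>w. (b w * (a w * log_deriv_inverse' F w) - a w * (b w * log_deriv_inverse' G w))\<^sup>2 / (F w * G w))
    \<longlongrightarrow> (b z * l1 - a z * l2)\<^sup>2 / (F z * G z)) (at z)"
    by (intro tendsto_intros t l1 l2 hab hol) (use nz in auto)
  moreover have "(b w * (a w * log_deriv_inverse' F w) - a w * (b w * log_deriv_inverse' G w))\<^sup>2 / (F w * G w) = W0 w" for w
  proof -
    have "(b w * (a w * log_deriv_inverse' F w) - a w * (b w * log_deriv_inverse' G w))\<^sup>2 = (H w)\<^sup>2 * (a w)\<^sup>2 * (b w)\<^sup>2"
      unfolding H_def by (simp add: power2_eq_square algebra_simps)
    then show ?thesis by (simp add: W0_def a_def b_def)
  qed
  ultimately show ?thesis using that by simp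
qed

lemma W_holomorphic: "W holomorphic_on UNIV"
proof -
  have ana: "k meromorphic_on UNIV" if "k holomorphic_on UNIV" for k :: "complex \<Rightarrow> complex"
    using that by (intro analytic_on_imp_meromorphic_on) (simp add: analytic_on_open)
  have hpoly: "(\<lambda>w. poly D (f w)) holomorphic_on UNIV" "(\<lambda>w. poly D (g w)) holomorphic_on UNIV"
    by (intro holomorphic_intros f g)+
  have "W0 meromorphic_on UNIV"
    unfolding W0_def H_def log_deriv_inverse'_def
    by (intro meromorphic_intros ana hol hpoly)
  then have iso: "isolated_singularity_at W0 z" for z
    by (intro meromorphic_on_isolated_singularity meromorphic_on_subset[of W0 UNIV "{z}"]) auto
  have "\<exists>l. (W0 \<longlongrightarrow> l) (at z)" for z
  proof (cases "f z \<in> S")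
    case True
    \<comment> \<open>A point sent into \<open>S\<close> is counted at least once, so equality of
      the counts puts f z and g z into \<open>S\<close> together or not at all; the mixed case never
      arises.\<close>
    have "nat (zorder (\<lambda>w. f w - f z) z) > 0"
      by (rule local_orders_at_shared_zero[OF f S True refl refl, where D=D]) simp
    then have "E_weighted f S 2 z \<noteq> 0" using True by (simp add: E_weighted_eq)
    then have "E_weighted g S 2 z \<noteq> 0" using share by (simp add: share_set_weight_def)
    then have "g z \<in> S" by (simp add: E_weighted_eq split: if_splits)
    then show ?thesis using W0_limit_at_zero[OF True] by blast
  next
    case False
    then have "E_weighted f S 2 z = 0" by (simp add: E_weighted_eq)
    then have "E_weighted g S 2 z = 0" using share by (simp add: share_set_weight_def)
    moreover have "nat (zorder (\<lambda>w. g w - g z) z) > 0" if "g z \<in> S"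
      by (rule local_orders_at_shared_zero[OF g S that refl refl, where D=D]) simp
    ultimately have "g z \<notin> S" by (auto simp: E_weighted_eq split: if_splits)
    then show ?thesis using W0_limit_off_zero[OF False] by blast
  qed
  then have "W analytic_on {z}" for z
    unfolding W_def using remove_sings_analytic_at[OF iso] by blast
  then have "W analytic_on UNIV" by (meson analytic_on_analytic_at)
  then show ?thesis by (simp add: analytic_on_open)
qed

lemma W_eq_W0:
  assumes nz: "F z \<noteq> 0" "G z \<noteq> 0" "deriv F z \<noteq> 0" "deriv G z \<noteq> 0"
  shows "W z = W0 z"
proof -
  have ana: "k analytic_on {z}" if "k holomorphic_on UNIV" for k :: "complex \<Rightarrow> complex"
    using that analytic_on_open[of UNIV k] analytic_on_subset by blast
  have h: "(\<lambda>w. poly D (f w)) holomorphic_on UNIV" "(\<lambda>w. poly D (g w)) holomorphic_on UNIV"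
    "deriv (deriv F) holomorphic_on UNIV" "deriv (deriv G) holomorphic_on UNIV"
    by (intro holomorphic_intros holomorphic_deriv f g hol open_UNIV)+
  have "W0 analytic_on {z}"
    unfolding W0_def H_def log_deriv_inverse'_def
    by (intro analytic_on_divide analytic_on_mult analytic_on_power analytic_on_diff analytic_on_const
          ana[OF hol(1)] ana[OF hol(2)] ana[OF hol(3)] ana[OF hol(4)] ana[OF hol(5)] ana[OF hol(6)]
          ana[OF h(1)] ana[OF h(2)] ana[OF h(3)] ana[OF h(4)]) (use nz in auto)
  then show ?thesis unfolding W_def by (rule remove_sings_at_analytic)
qed

text \<open>The exponent 6 splits evenly: |H| <= 6\<Lambda> enters squared, and each of (f' D(f))^2
  (1 + |f|) and (g' D(g))^2 (1 + |g|) costs \<Lambda>^2 while cancelling |F| or |G|.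
  \<open>F\<close>, \<open>G\<close> and their derivatives are listed for the sake of
  \<open>H\<close>, the differences with points of \<open>S\<close> for the interpolation bound. The
  added 1 keeps \<open>A\<close> positive.\<close>

lemma W_bound:
  obtains A where "A > 0" "\<And>z \<Lambda>. \<Lambda> \<ge> 1 \<Longrightarrow>
    (\<And>h. h \<in> {F, G, deriv F, deriv G} \<union> (\<lambda>a w. f w - a) ` S \<union> (\<lambda>a w. g w - a) ` S \<Longrightarrow>
        h z \<noteq> 0 \<and> cmod (deriv h z) \<le> \<Lambda> * cmod (h z)) \<Longrightarrow>
    cmod (W z) * (1 + cmod (f z)) * (1 + cmod (g z)) \<le> A * \<Lambda> ^ 6"
proof -
  obtain C where C: "C \<ge> 0" "\<And>w d \<Lambda>. \<Lambda> \<ge> 0 \<Longrightarrow> (\<And>a. a \<in> S \<Longrightarrow> cmod d \<le> \<Lambda> * cmod (w - a)) \<Longrightarrow>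
     (cmod (d * poly D w))\<^sup>2 * (1 + cmod w) \<le> C * \<Lambda>\<^sup>2 * cmod (poly Q w)"
    unfolding Q_def using squared_factor_bound[OF S deg] by blast
  show ?thesis
  proof (rule that[of "36 * C\<^sup>2 + 1"])
    show "36 * C\<^sup>2 + 1 > 0" by (simp add: add_nonneg_pos)
    fix z \<Lambda> assume L: "\<Lambda> \<ge> 1" and hs: "\<And>h. h \<in> {F, G, deriv F, deriv G} \<union> (\<lambda>a w. f w - a) ` S \<union> (\<lambda>a w. g w - a) ` S \<Longrightarrow>
        h z \<noteq> 0 \<and> cmod (deriv h z) \<le> \<Lambda> * cmod (h z)"
    have nz: "F z \<noteq> 0" "G z \<noteq> 0" "deriv F z \<noteq> 0" "deriv G z \<noteq> 0" using hs by auto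
    have ld: "cmod (deriv h z / h z) \<le> \<Lambda>" if "h \<in> {F, G, deriv F, deriv G}" for h
      using hs[of h] that by (auto simp: norm_divide divide_simps)
    have Lb: "cmod (log_deriv_inverse' k z) \<le> 3 * \<Lambda>" if "k = F \<or> k = G" for k
    proof -
      have "cmod (log_deriv_inverse' k z) \<le> cmod (deriv (deriv k) z / deriv k z) + 2 * cmod (deriv k z / k z)"
        unfolding log_deriv_inverse'_def
        by (metis norm_triangle_ineq4 norm_mult norm_numeral)
      also have "\<dots> \<le> \<Lambda> + 2 * \<Lambda>" using ld[of k] ld[of "deriv k"] that by auto
      finally show ?thesis by simp
    qed
    have "cmod (H z) \<le> cmod (log_deriv_inverse' F z) + cmod (log_deriv_inverse' G z)"
      unfolding H_def by (rule norm_triangle_ineq4)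
    also have "\<dots> \<le> 6 * \<Lambda>" using Lb[of F] Lb[of G] by simp
    finally have Hb: "(cmod (H z))\<^sup>2 \<le> (6 * \<Lambda>)\<^sup>2" by (intro power_mono) auto
    have dsub: "deriv (\<lambda>w. k w - a) z = deriv k z" if "k holomorphic_on UNIV" for k :: "complex \<Rightarrow> complex" and a
      using that by (subst deriv_diff) (auto simp: holomorphic_on_imp_differentiable_at)
    have fb: "(cmod (deriv f z * poly D (f z)))\<^sup>2 * (1 + cmod (f z)) \<le> C * \<Lambda>\<^sup>2 * cmod (F z)"
      unfolding F_def
    proof (rule C(2))
      fix a assume "a \<in> S"
      then show "cmod (deriv f z) \<le> \<Lambda> * cmod (f z - a)" using hs[of "\<lambda>w. f w - a"] dsub[OF f(1), of a] by auto
    qed (use L in auto)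
    have gb: "(cmod (deriv g z * poly D (g z)))\<^sup>2 * (1 + cmod (g z)) \<le> C * \<Lambda>\<^sup>2 * cmod (G z)"
      unfolding G_def
    proof (rule C(2))
      fix a assume "a \<in> S"
      then show "cmod (deriv g z) \<le> \<Lambda> * cmod (g z - a)" using hs[of "\<lambda>w. g w - a"] dsub[OF g(1), of a] by auto
    qed (use L in auto)
    let ?x = "(cmod (deriv f z * poly D (f z)))\<^sup>2 * (1 + cmod (f z))"
    let ?y = "(cmod (deriv g z * poly D (g z)))\<^sup>2 * (1 + cmod (g z))"
    have "cmod (W z) * (1 + cmod (f z)) * (1 + cmod (g z)) = (cmod (H z))\<^sup>2 * (?x * ?y) / (cmod (F z) * cmod (G z))"
      unfolding W_eq_W0[OF nz] W0_def by (simp add: norm_mult norm_divide norm_power)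
    also have "\<dots> \<le> (6 * \<Lambda>)\<^sup>2 * ((C * \<Lambda>\<^sup>2 * cmod (F z)) * (C * \<Lambda>\<^sup>2 * cmod (G z))) / (cmod (F z) * cmod (G z))"
      using C(1) by (intro divide_right_mono mult_mono Hb fb gb) auto
    also have "\<dots> = 36 * C\<^sup>2 * \<Lambda> ^ 6" using nz by (simp add: field_simps power2_eq_square eval_nat_numeral)
    also have "\<dots> \<le> (36 * C\<^sup>2 + 1) * \<Lambda> ^ 6" using L by (intro mult_right_mono) auto
    finally show "cmod (W z) * (1 + cmod (f z)) * (1 + cmod (g z)) \<le> (36 * C\<^sup>2 + 1) * \<Lambda> ^ 6" .
  qed
qed

end

section \<open>Growth of polynomial compositions and of translates\<close>

text \<open>Constants go into the exponent by 1 + |a| <= exp(|a|\<mu>) for \<mu> >= 1, so composing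
  with a polynomial merely multiplies \<mu>, which is the form the growth step asks for.\<close>

lemma poly_exp_bound:
  fixes P :: "complex poly"
  shows "\<exists>B\<ge>1. \<forall>\<mu>\<ge>1. \<forall>w. cmod w \<le> exp \<mu> \<longrightarrow> cmod (poly P w) \<le> exp (B * \<mu>)"
proof (induction P)
  case 0
  then show ?case by (intro exI[of _ 1]) auto
next
  case (pCons a P)
  then obtain B where B: "B \<ge> 1" "\<And>\<mu> w. \<mu> \<ge> 1 \<Longrightarrow> cmod w \<le> exp \<mu> \<Longrightarrow> cmod (poly P w) \<le> exp (B * \<mu>)"
    by blast
  show ?case
  proof (intro exI[of _ "1 + B + cmod a"] conjI allI impI)
    show "1 \<le> 1 + B + cmod a" using B(1) by simp
    fix \<mu> :: real and w assume mu: "\<mu> \<ge> 1" and w: "cmod w \<le> exp \<mu>"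
    define x where "x = exp ((1 + B) * \<mu>)"
    have x1: "x \<ge> 1" using B(1) mu by (simp add: x_def)
    have "cmod (poly (pCons a P) w) \<le> cmod a + cmod w * cmod (poly P w)"
      using norm_triangle_ineq[of a "w * poly P w"] by (simp add: norm_mult)
    also have "\<dots> \<le> cmod a + exp \<mu> * exp (B * \<mu>)"
      by (intro add_mono mult_mono w B mu) auto
    also have "\<dots> = cmod a + x" by (simp add: x_def distrib_right exp_add)
    also have "\<dots> \<le> cmod a * x + x" using x1 mult_left_mono[OF x1 norm_ge_zero[of a]] by simp
    also have "\<dots> = (1 + cmod a) * x" by (simp add: distrib_right)
    also have "\<dots> \<le> exp (cmod a) * x" using x1 by (intro mult_right_mono exp_ge_add_one_self) auto
    also have "\<dots> \<le> exp (cmod a * \<mu>) * x"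
      using mu x1 mult_left_mono[OF mu norm_ge_zero[of a]] by (intro mult_right_mono) auto
    also have "\<dots> = exp ((1 + B + cmod a) * \<mu>)" by (simp add: x_def exp_add[symmetric] algebra_simps)
    finally show "cmod (poly (pCons a P) w) \<le> exp ((1 + B + cmod a) * \<mu>)" .
  qed
qed

text \<open>Because |z + z0| + 1 <= (1 + |z0|)(|z| + 1), a translation changes only the constant.
  This serves both for g(z) = f(z + c) and for moving a base point to the origin.\<close>

lemma double_exp_growth_shift:
  fixes f :: "complex \<Rightarrow> complex"
  assumes c: "c \<ge> 1" "\<And>z. cmod (f z) \<le> exp (exp (c * (cmod z + 1)))"
    and c': "c * (1 + cmod z0) \<le> c'"
  shows "cmod (f (z + z0)) \<le> exp (exp (c' * (cmod z + 1)))"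
proof -
  have "cmod (z + z0) + 1 \<le> (1 + cmod z0) * (cmod z + 1)"
  proof -
    have "(1 + cmod z0) * (cmod z + 1) = cmod z + cmod z0 + 1 + cmod z * cmod z0" by (simp add: algebra_simps)
    moreover have "0 \<le> cmod z * cmod z0" by simp
    ultimately show ?thesis using norm_triangle_ineq[of z z0] by linarith
  qed
  then have "c * (cmod (z + z0) + 1) \<le> c * ((1 + cmod z0) * (cmod z + 1))"
    using c(1) by (intro mult_left_mono) auto
  also have "\<dots> \<le> c' * (cmod z + 1)"
    unfolding mult.assoc[symmetric] by (intro mult_right_mono c') auto
  finally have "exp (exp (c * (cmod (z + z0) + 1))) \<le> exp (exp (c' * (cmod z + 1)))" by simp
  then show ?thesis using c(2)[of "z + z0"] by linarith
qed

lemma deriv_translate: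
  fixes h :: "complex \<Rightarrow> complex"
  assumes "h holomorphic_on UNIV"
  shows "deriv (\<lambda>z. h (z + z0)) z = deriv h (z + z0)"
proof -
  have "(h has_field_derivative deriv h (z + z0)) (at (z + z0))" using assms holomorphic_derivI by blast
  then show ?thesis by (intro DERIV_imp_deriv) (simp add: DERIV_shift)
qed

lemma holomorphic_translate:
  fixes h :: "complex \<Rightarrow> complex"
  assumes "h holomorphic_on UNIV"
  shows "(\<lambda>z. h (z + z0)) holomorphic_on UNIV"
  by (rule holomorphic_on_compose_gen[unfolded o_def, OF _ assms]) (auto intro!: holomorphic_intros)

section \<open>The alternatives H nonzero somewhere and H identically zero\<close>

context shared_zeros
begin

text \<open>The growth step is normalised at the origin, hence the translation \<open>T\<close> by a
  point \<open>z0\<close> at which \<open>W\<close> and all functions in \<open>Hs\<close> are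
  nonzero. The polynomial found is translated back at the end.\<close>

lemma polynomial_if_H_nonzero:
  assumes c: "c \<ge> 1" "\<And>z. cmod (f z) \<le> exp (exp (c * (cmod z + 1)))" "\<And>z. cmod (g z) \<le> exp (exp (c * (cmod z + 1)))"
    and z0: "F z0 \<noteq> 0" "G z0 \<noteq> 0" "deriv F z0 \<noteq> 0" "deriv G z0 \<noteq> 0" "H z0 \<noteq> 0" "poly D (f z0) \<noteq> 0" "poly D (g z0) \<noteq> 0"
  shows "\<exists>p. \<forall>z. f z = poly p z"
proof -
  define Hs where "Hs = {F, G, deriv F, deriv G} \<union> (\<lambda>a w. f w - a) ` S \<union> (\<lambda>a w. g w - a) ` S"
  define T where "T = (\<lambda>(h :: complex \<Rightarrow> complex) z. h (z + z0))"
  have Hshol: "h holomorphic_on UNIV" if "h \<in> Hs" for h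
    using that unfolding Hs_def by (auto intro!: hol holomorphic_intros f g)
  have nzS: "f z0 \<notin> S" "g z0 \<notin> S" using z0(1,2) poly_Q_eq_0 by (auto simp: F_def G_def)
  have "\<exists>z. f z \<noteq> 0" "\<exists>z. g z \<noteq> 0" using f(2) g(2) by blast+
  then obtain wf wg where wfg: "f wf \<noteq> 0" "g wg \<noteq> 0" by blast
  obtain A where A: "A > 0" "\<And>z \<Lambda>. \<Lambda> \<ge> 1 \<Longrightarrow>
    (\<And>h. h \<in> Hs \<Longrightarrow> h z \<noteq> 0 \<and> cmod (deriv h z) \<le> \<Lambda> * cmod (h z)) \<Longrightarrow>
    cmod (W z) * (1 + cmod (f z)) * (1 + cmod (g z)) \<le> A * \<Lambda> ^ 6"
  proof (rule W_bound[folded Hs_def])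
    fix A assume "A > 0" and A: "\<And>z \<Lambda>. \<Lambda> \<ge> 1 \<Longrightarrow>
      (\<And>h. h \<in> Hs \<Longrightarrow> h z \<noteq> 0 \<and> cmod (deriv h z) \<le> \<Lambda> * cmod (h z)) \<Longrightarrow>
      cmod (W z) * (1 + cmod (f z)) * (1 + cmod (g z)) \<le> A * \<Lambda> ^ 6"
    show thesis by (rule that[OF \<open>A > 0\<close> A])
  qed
  have "\<forall>P. \<exists>B\<ge>1. \<forall>\<mu>\<ge>1. \<forall>w. cmod w \<le> exp \<mu> \<longrightarrow> cmod (poly P w) \<le> exp (B * \<mu>)"
    using poly_exp_bound by blast
  then obtain B where B: "\<And>P. B P \<ge> 1" "\<And>P \<mu> w. \<mu> \<ge> 1 \<Longrightarrow> cmod w \<le> exp \<mu> \<Longrightarrow> cmod (poly P w) \<le> exp (B P * \<mu>)"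
    by metis
  \<comment> \<open>A sum dominates each of the finitely many exponents, those of \<open>Q\<close>
    and of the linear polynomials w - a, so one constant serves all compositions.\<close>
  define B' where "B' = B Q + (\<Sum>a\<in>S. B [:-a, 1:])"
  have Bnn: "B P \<ge> 0" for P using B(1)[of P] by simp
  have B'1: "B' \<ge> 1" unfolding B'_def using B(1)[of Q] by (intro add_increasing2 sum_nonneg Bnn) 
  have BQ: "B Q \<le> B'" unfolding B'_def by (simp add: sum_nonneg Bnn)
  have Ba: "B [:-a, 1:] \<le> B'" if "a \<in> S" for a
  proof -
    have "B [:-a, 1:] \<le> (\<Sum>a\<in>S. B [:-a, 1:])" by (rule member_le_sum[OF that _ S]) (rule Bnn)
    then show ?thesis using Bnn[of Q] by (simp add: B'_def)
  qed
  have growth: "cmod (T h z) \<le> exp (B' * \<mu>)"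
    if h: "h \<in> Hs" and mu: "\<mu> \<ge> 1"
      and fg: "\<And>w. cmod w \<le> R + 1 \<Longrightarrow> cmod (T f w) \<le> exp \<mu> \<and> cmod (T g w) \<le> exp \<mu>"
      and z: "cmod z \<le> R" for h R \<mu> z
  proof -
    have pb: "cmod (poly P (k (w + z0))) \<le> exp (B' * \<mu>)" if "k = f \<or> k = g" "cmod w \<le> R + 1" "B P \<le> B'" for P k w
    proof -
      have "cmod (poly P (k (w + z0))) \<le> exp (B P * \<mu>)"
        by (rule B(2)[OF mu]) (use fg[OF that(2)] that(1) in \<open>auto simp: T_def\<close>)
      also have "\<dots> \<le> exp (B' * \<mu>)" using that(3) mu by (auto intro!: mult_right_mono)
      finally show ?thesis .
    qed
    \<comment> \<open>Cauchy's estimate on a unit disc carries the bounds of \<open>F\<close> and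
      \<open>G\<close> over to their derivatives with the same exponent; this is the origin of R + 1
      in the growth hypothesis.\<close>
    have dd: "cmod (deriv k (z + z0)) \<le> exp (B' * \<mu>)"
      if k: "k holomorphic_on UNIV" "\<And>w. cmod w \<le> R + 1 \<Longrightarrow> cmod (k (w + z0)) \<le> exp (B' * \<mu>)" for k
    proof -
      have "cmod ((deriv ^^ 1) k (z + z0)) \<le> fact 1 * exp (B' * \<mu>) / 1 ^ 1"
      proof (rule Cauchy_inequality)
        show "k holomorphic_on ball (z + z0) 1" by (rule holomorphic_on_subset[OF k(1)]) auto
        show "continuous_on (cball (z + z0) 1) k"
          by (rule continuous_on_subset[OF holomorphic_on_imp_continuous_on[OF k(1)]]) auto
        fix x assume x: "cmod (z + z0 - x) = 1"
        have "cmod (x - z0) \<le> cmod z + cmod (x - z0 - z)" by (rule norm_triangle_sub)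
        also have "cmod (x - z0 - z) = 1" using x by (metis diff_diff_add add.commute norm_minus_commute)
        finally show "cmod (k x) \<le> exp (B' * \<mu>)" using k(2)[of "x - z0"] z by simp
      qed auto
      then show ?thesis by simp
    qed
    have FG: "cmod (F (w + z0)) \<le> exp (B' * \<mu>)" "cmod (G (w + z0)) \<le> exp (B' * \<mu>)" if "cmod w \<le> R + 1" for w
      using pb[of f w Q] pb[of g w Q] that BQ by (auto simp: F_def G_def)
    from h consider "h = F" | "h = G" | "h = deriv F" | "h = deriv G" | a where "a \<in> S" "h = (\<lambda>w. f w - a)"
      | a where "a \<in> S" "h = (\<lambda>w. g w - a)" unfolding Hs_def by auto
    then show ?thesis
    proof cases
      case 5
      then show ?thesis using pb[of f z "[:-a, 1:]"] Ba[of a] z by (simp add: T_def)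
    next
      case 6
      then show ?thesis using pb[of g z "[:-a, 1:]"] Ba[of a] z by (simp add: T_def)
    qed (use FG[of z] dd[OF hol(1) FG(1)] dd[OF hol(2) FG(2)] z in \<open>auto simp: T_def\<close>)
  qed
  have W0z: "W z0 \<noteq> 0"
  proof -
    have "deriv f z0 \<noteq> 0" "deriv g z0 \<noteq> 0"
      using z0(3,4) deriv_poly_compose[OF f(1), of Q] deriv_poly_compose[OF g(1), of Q]
      by (auto simp: F_def G_def)
    then show ?thesis unfolding W_eq_W0[OF z0(1-4)] W0_def using z0 by simp
  qed
  obtain C N where CN: "C \<ge> 1" "\<And>R \<mu> z. R \<ge> 1 \<Longrightarrow> \<mu> \<ge> 1 \<Longrightarrow>
      (\<And>w. cmod w \<le> 7 * R \<Longrightarrow> cmod (T f w) \<le> exp \<mu> \<and> cmod (T g w) \<le> exp \<mu>) \<Longrightarrow>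
      cmod z \<le> R / 4 \<Longrightarrow> cmod (T f z) \<le> C * \<mu> ^ N \<and> cmod (T g z) \<le> C * \<mu> ^ N"
  proof (rule growth_step[of "T f" "T g" "T W" "wf - z0" "wg - z0" "T ` Hs" A 6 B'])
    show "T f holomorphic_on UNIV" "T g holomorphic_on UNIV" "T W holomorphic_on UNIV"
      unfolding T_def by (intro holomorphic_translate f g W_holomorphic)+
    show "T f (wf - z0) \<noteq> 0" "T g (wg - z0) \<noteq> 0" "T W 0 \<noteq> 0" using wfg W0z by (auto simp: T_def)
    show "finite (T ` Hs)" using S by (auto simp: Hs_def)
    show "h holomorphic_on UNIV" if "h \<in> T ` Hs" for h
      using that Hshol holomorphic_translate by (auto simp: T_def)
    show "h 0 \<noteq> 0" if "h \<in> T ` Hs" for h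
      using that z0 nzS by (auto simp: T_def Hs_def)
    show "A > 0" "B' \<ge> 1" by fact+
    show "cmod (T W z) * (1 + cmod (T f z)) * (1 + cmod (T g z)) \<le> A * \<Lambda> ^ 6"
      if "\<Lambda> \<ge> 1" "\<And>h. h \<in> T ` Hs \<Longrightarrow> h z \<noteq> 0 \<and> cmod (deriv h z) \<le> \<Lambda> * cmod (h z)" for z \<Lambda>
      unfolding T_def
    proof (rule A(2)[OF that(1)])
      fix h assume h: "h \<in> Hs"
      have "deriv (T h) z = deriv h (z + z0)" unfolding T_def by (rule deriv_translate[OF Hshol[OF h]])
      then show "h (z + z0) \<noteq> 0 \<and> cmod (deriv h (z + z0)) \<le> \<Lambda> * cmod (h (z + z0))"
        using that(2)[of "T h"] h by (auto simp: T_def)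
    qed
    show "cmod (h z) \<le> exp (B' * \<mu>)" if "h \<in> T ` Hs" "1 \<le> \<mu>"
      "\<And>w. cmod w \<le> R + 1 \<Longrightarrow> cmod (T f w) \<le> exp \<mu> \<and> cmod (T g w) \<le> exp \<mu>" "cmod z \<le> R" for h R \<mu> z
      using growth[OF _ that(2,3,4)] that(1) by auto
    fix C N assume "C \<ge> 1" and CN: "\<And>R \<mu> z. R \<ge> 1 \<Longrightarrow> \<mu> \<ge> 1 \<Longrightarrow>
      (\<And>w. cmod w \<le> 7 * R \<Longrightarrow> cmod (T f w) \<le> exp \<mu> \<and> cmod (T g w) \<le> exp \<mu>) \<Longrightarrow>
      cmod z \<le> R / 4 \<Longrightarrow> cmod (T f z) \<le> C * \<mu> ^ N \<and> cmod (T g z) \<le> C * \<mu> ^ N"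
    show thesis by (rule that[OF \<open>C \<ge> 1\<close> CN])
  qed
  define c' where "c' = c * (1 + cmod z0)"
  have c': "c' \<ge> 1" using c(1) mult_mono[of 1 c 1 "1 + cmod z0"] by (simp add: c'_def)
  have "\<exists>p. \<forall>z. T f z = poly p z"
  proof (rule polynomial_of_growth_step[of "T f" c' "T g" C N])
    show "T f holomorphic_on UNIV" unfolding T_def by (intro holomorphic_translate f)
    show "cmod (T f z) \<le> exp (exp (c' * (cmod z + 1)))" "cmod (T g z) \<le> exp (exp (c' * (cmod z + 1)))" for z
      unfolding T_def by (rule double_exp_growth_shift[OF c(1) c(2)], simp add: c'_def)
        (rule double_exp_growth_shift[OF c(1) c(3)], simp add: c'_def)
  qed (use c' CN in auto)
  then obtain p where p: "\<And>z. f (z + z0) = poly p z" by (auto simp: T_def)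
  have "f z = poly (pcompose p [:-z0, 1:]) z" for z
    using p[of "z - z0"] by (simp add: poly_pcompose)
  then show ?thesis by blast
qed

lemma eventually_good_point:
  "eventually (\<lambda>z. F z \<noteq> 0 \<and> G z \<noteq> 0 \<and> deriv F z \<noteq> 0 \<and> deriv G z \<noteq> 0) (at z)"
proof -
  have *: "deriv F = (\<lambda>z. poly (pderiv Q) (f z) * deriv f z)" "deriv G = (\<lambda>z. poly (pderiv Q) (g z) * deriv g z)"
    unfolding F_def G_def by (intro deriv_poly_compose f g)+
  show ?thesis
    using eventually_poly_entire_nonzero[OF f Qnz(1), of z] eventually_poly_entire_nonzero[OF g Qnz(1), of z]
      eventually_poly_entire_nonzero[OF f Qnz(2), of z] eventually_poly_entire_nonzero[OF g Qnz(2), of z]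
      eventually_deriv_entire_nonzero[OF f, of z] eventually_deriv_entire_nonzero[OF g, of z]
    by eventually_elim (auto simp: F_def G_def *[unfolded F_def G_def])
qed

text \<open>\<open>H\<close> is the logarithmic derivative of \<kappa> = (F'/F^2)/(G'/G^2), so
  \<kappa> is a constant A. Then (1/F)' = A (1/G)', and integrating once more gives 1/F - A/G = B.
  Both integrations take place on a ball free of zeros of F, G, F' and G'.\<close>

lemma Moebius_relation_if_H_zero:
  assumes H0: "\<And>z. F z \<noteq> 0 \<Longrightarrow> G z \<noteq> 0 \<Longrightarrow> deriv F z \<noteq> 0 \<Longrightarrow> deriv G z \<noteq> 0 \<Longrightarrow> H z = 0"
  obtains A B where "A \<noteq> 0" "\<And>z. G z = A * F z + B * F z * G z"
proof -
  define U where "U = {z. F z * G z * deriv F z * deriv G z \<noteq> 0}"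
  have "open U" unfolding U_def
    by (intro open_Collect_neq holomorphic_on_imp_continuous_on holomorphic_intros hol continuous_on_const)
  moreover have "\<exists>z. z \<in> U"
    using eventually_happens[OF eventually_good_point[of 0]] by (auto simp: U_def trivial_limit_at)
  then obtain z0 where "z0 \<in> U" by blast
  ultimately obtain e where e: "e > 0" "ball z0 e \<subseteq> U" using open_contains_ball by blast
  have nz: "F z \<noteq> 0" "G z \<noteq> 0" "deriv F z \<noteq> 0" "deriv G z \<noteq> 0" if "z \<in> ball z0 e" for z
    using that e(2) by (auto simp: U_def)
  have d: "(F has_field_derivative deriv F z) (at z)" "(G has_field_derivative deriv G z) (at z)"
    "(deriv F has_field_derivative deriv (deriv F) z) (at z)" "(deriv G has_field_derivative deriv (deriv G) z) (at z)" for z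
    using hol holomorphic_derivI by blast+
  define \<kappa> where "\<kappa> = (\<lambda>z. (deriv F z * (G z)\<^sup>2) / (deriv G z * (F z)\<^sup>2))"
  have "\<exists>A. \<forall>z\<in>ball z0 e. \<kappa> z = A"
  proof (rule has_field_derivative_zero_constant)
    fix z assume z: "z \<in> ball z0 e"
    let ?d = "((deriv (deriv F) z * (G z)\<^sup>2 + deriv F z * (2 * G z * deriv G z)) * (deriv G z * (F z)\<^sup>2)
       - (deriv F z * (G z)\<^sup>2) * (deriv (deriv G) z * (F z)\<^sup>2 + deriv G z * (2 * F z * deriv F z)))
       / ((deriv G z * (F z)\<^sup>2) * (deriv G z * (F z)\<^sup>2))"
    have k: "(\<kappa> has_field_derivative ?d) (at z)"
    proof -
      have n: "((\<lambda>z. deriv F z * (G z)\<^sup>2) has_field_derivative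
           (deriv (deriv F) z * (G z)\<^sup>2 + deriv F z * (2 * G z * deriv G z))) (at z)"
        "((\<lambda>z. deriv G z * (F z)\<^sup>2) has_field_derivative
           (deriv (deriv G) z * (F z)\<^sup>2 + deriv G z * (2 * F z * deriv F z))) (at z)"
        by (auto intro!: derivative_eq_intros d)
      show ?thesis unfolding \<kappa>_def by (rule DERIV_divide[OF n]) (use nz[OF z] in auto)
    qed
    have "?d = 0"
    proof -
      have "deriv (deriv F) z / deriv F z - 2 * (deriv F z / F z) = deriv (deriv G) z / deriv G z - 2 * (deriv G z / G z)"
        using H0[OF nz[OF z]] by (simp add: H_def log_deriv_inverse'_def)
      moreover have "?d = \<kappa> z * ((deriv (deriv F) z / deriv F z - 2 * (deriv F z / F z)) -
          (deriv (deriv G) z / deriv G z - 2 * (deriv G z / G z)))"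
        unfolding \<kappa>_def using nz[OF z] by (simp add: divide_simps) (simp add: algebra_simps power2_eq_square)
      ultimately show ?thesis by simp
    qed
    then show "(\<kappa> has_field_derivative 0) (at z within ball z0 e)" using k has_field_derivative_at_within by metis
  qed auto
  then obtain A where A: "\<And>z. z \<in> ball z0 e \<Longrightarrow> \<kappa> z = A" by blast
  have A0: "A \<noteq> 0" using A[of z0] nz[of z0] e(1) by (auto simp: \<kappa>_def)
  have "\<exists>B. \<forall>z\<in>ball z0 e. 1 / F z - A / G z = B"
  proof (rule has_field_derivative_zero_constant)
    fix z assume z: "z \<in> ball z0 e"
    have "((\<lambda>z. 1 / F z - A / G z) has_field_derivative (- deriv F z / (F z)\<^sup>2 + A * deriv G z / (G z)\<^sup>2)) (at z)"
      using nz[OF z] by (auto intro!: derivative_eq_intros d simp: power2_eq_square)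
    moreover have "- deriv F z / (F z)\<^sup>2 + A * deriv G z / (G z)\<^sup>2 = 0"
      using A[OF z] nz[OF z] unfolding \<kappa>_def by (simp add: field_simps)
    ultimately show "((\<lambda>z. 1 / F z - A / G z) has_field_derivative 0) (at z within ball z0 e)"
      using has_field_derivative_at_within by metis
  qed auto
  then obtain B where B: "\<And>z. z \<in> ball z0 e \<Longrightarrow> 1 / F z - A / G z = B" by blast
  \<comment> \<open>With denominators cleared the relation concerns an entire function, and it
    spreads from the ball to the plane by the isolation of zeros.\<close>
  define k where "k = (\<lambda>z. G z - (A * F z + B * F z * G z))"
  have k0: "k z = 0" if "z \<in> ball z0 e" for z
    unfolding k_def B[OF that, symmetric] using nz[OF that] by (simp add: field_simps)
  have "k z = 0" for z
  proof (rule ccontr)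
    assume "k z \<noteq> 0"
    moreover have "k holomorphic_on UNIV" unfolding k_def by (intro holomorphic_intros hol)
    ultimately have "eventually (\<lambda>w. k w \<noteq> 0) (at z0)" by (intro eventually_entire_nonzero)
    moreover have "eventually (\<lambda>w. w \<in> ball z0 e - {z0}) (at z0)" using e(1) by (intro eventually_at_in_open) auto
    ultimately have "eventually (\<lambda>w. False) (at z0)" by eventually_elim (use k0 in auto)
    then show False by (simp add: trivial_limit_at)
  qed
  then show ?thesis using that[OF A0, of B] by (simp add: k_def)
qed

end

section \<open>Polynomials with a one-point fibre, and identities between entire functions\<close>

text \<open>If Q - v has a single zero e, it equals b (z - e)^m, so Q' can vanish at e only. This is
  what conflicts with k >= 2.\<close>

lemma poly_shift_one_root:
  fixes Q :: "complex poly"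
  assumes "degree Q \<ge> 1" and one: "\<And>x y. poly Q x = v \<Longrightarrow> poly Q y = v \<Longrightarrow> x = y"
  shows "card {z. poly (pderiv Q) z = 0} \<le> 1"
proof -
  define P where "P = Q - [:v:]"
  have degP: "degree P \<ge> 1"
  proof (rule ccontr)
    assume "\<not> ?thesis"
    then obtain b where "P = [:b:]" by (metis degree_eq_zeroE not_less_eq_eq One_nat_def le_zero_eq)
    then have "Q = [:b + v:]" by (simp add: P_def diff_eq_eq)
    then show False using assms(1) by simp
  qed
  then have P0: "P \<noteq> 0" by auto
  obtain e where e: "poly P e = 0"
    using alg_closed_imp_poly_has_root[of P] degP by auto
  obtain q where q: "P = [:-e, 1:] ^ order e P * q" "\<not> [:-e, 1:] dvd q"
    using order_decomp[OF P0] by blast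
  have "poly q x \<noteq> 0" for x
  proof
    assume x: "poly q x = 0"
    then have "poly P x = 0" by (metis q(1) poly_mult mult_zero_right)
    then have "x = e" using one[of x e] e by (simp add: P_def)
    then show False using x q(2) by (simp add: poly_eq_0_iff_dvd)
  qed
  then have "degree q = 0" using alg_closed_imp_poly_has_root[of q] by auto
  then obtain b where b: "q = [:b:]" by (metis degree_eq_zeroE)
  have b0: "b \<noteq> 0" using q(1) b P0 by auto
  define m where "m = order e P"
  have m: "m > 0" using e P0 by (simp add: m_def order_root)
  have P: "P = smult b ([:-e, 1:] ^ m)" using q(1) unfolding b m_def by simp
  have "pderiv Q = pderiv P" by (simp add: P_def pderiv_diff pderiv_pCons)
  also have "\<dots> = smult b (smult (of_nat m) ([:-e, 1:] ^ (m - 1)))"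
    unfolding P pderiv_smult pderiv_power by (simp add: pderiv_pCons)
  finally have "{z. poly (pderiv Q) z = 0} \<subseteq> {e}" using b0 m by auto
  then show ?thesis using card_mono[of "{e}"] by fastforce
qed

lemma nonconstant_mero_entire:
  assumes "f holomorphic_on UNIV" "\<not> (\<exists>c. \<forall>z. f z = c)"
  shows "nonconstant_mero f"
  unfolding nonconstant_mero_def
proof (intro conjI notI)
  show "f meromorphic_on UNIV"
    using assms(1) by (intro analytic_on_imp_meromorphic_on) (simp add: analytic_on_open)
  assume "\<exists>c. \<forall>\<^sub>\<approx>z. f z = c"
  then obtain c where c: "\<forall>\<^sub>\<approx>z. f z = c" by blast
  have "eventually (\<lambda>z. f z = c) (at 0)" by (rule eventually_cosparse_imp_eventually_at[OF c UNIV_I])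
  moreover have "eventually (\<lambda>z. f z \<noteq> c) (at 0)" by (rule eventually_entire_neq[OF assms])
  ultimately have "eventually (\<lambda>z. False) (at (0::complex))" by eventually_elim auto
  then show False by (simp add: trivial_limit_at)
qed

text \<open>A cosparse identity holds on a punctured neighbourhood of 0, where a difference of
  entire functions that is not identically zero would have no zeros. Strong uniqueness is phrased up
  to sparse sets, so its conclusion needs this upgrade.\<close>

lemma cosparse_eq_imp_eq_entire:
  assumes "f holomorphic_on UNIV" "g holomorphic_on UNIV" "\<forall>\<^sub>\<approx>z. f z = g z"
  shows "f z = g z"
proof (rule ccontr)
  assume "f z \<noteq> g z"
  moreover have "(\<lambda>z. f z - g z) holomorphic_on UNIV" by (intro holomorphic_intros assms)
  ultimately have "eventually (\<lambda>z. f z - g z \<noteq> 0) (at 0)"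
    by (intro eventually_entire_nonzero[of "\<lambda>z. f z - g z" z]) auto
  moreover have "eventually (\<lambda>z. f z = g z) (at 0)"
    by (rule eventually_cosparse_imp_eventually_at[OF assms(3) UNIV_I])
  ultimately have "eventually (\<lambda>z. False) (at (0::complex))" by eventually_elim auto
  then show False by (simp add: trivial_limit_at)
qed

theorem theorem2p1:
  fixes n :: nat and a :: "nat \<Rightarrow> complex" and Q :: "complex poly"
    and f :: "complex \<Rightarrow> complex" and c :: complex and S :: "complex set"
    and m1 m2 k :: nat
  assumes "n \<ge> 1"
    and "Q = (\<Prod>i=1..n. [:- a i, 1:])"
    and "inj_on a {1..n}"
    and "strong_uniqueness_poly Q"
    and "S = a ` {1..n}"
    and "m1 = card {z. poly (Q - [:poly Q 0:]) z = 0 \<and> order z (Q - [:poly Q 0:]) = 1}"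
    and "m2 = card {z. poly (Q - [:poly Q 0:]) z = 0 \<and> order z (Q - [:poly Q 0:]) \<ge> 2}"
    and "k = card {z. poly (pderiv Q) z = 0}"
    and "n > max (2 * k + 2) (m1 + m2)"
    and "m1 + m2 > 2"
    and "k \<ge> 2"
    and "transcendental_entire f"
    and "hyper_order_entire f < 1"
    and "c \<noteq> 0"
    and "share_set_weight f (\<lambda>z. f (z + c)) S 2"
  shows "\<forall>z. f z = f (z + c)"
proof -
  define g where "g = (\<lambda>z. f (z + c))"
  define D where "D = (\<Prod>d\<in>{z. poly (pderiv Q) z = 0}. [:-d, 1:] :: complex poly)"
  have cardS: "card S = n" using assms(3,5) by (simp add: card_image)
  have QS: "Q = (\<Prod>x\<in>S. [:-x, 1:])"
    unfolding assms(2,5) by (subst prod.reindex[OF assms(3)]) simp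
  have finS: "finite S" using assms(5) by simp
  have degree_Q: "degree Q = n" unfolding QS using degree_prod_linear[OF finS] cardS by simp
  have "pderiv Q \<noteq> 0" using degree_Q assms(1) by (auto simp: pderiv_eq_0_iff)
  then have finD: "finite {z. poly (pderiv Q) z = 0}" by (rule poly_roots_finite)
  have degD: "degree D = k" unfolding D_def using degree_prod_linear[OF finD] assms(8) by simp
  have rootD: "poly D d = 0 \<longleftrightarrow> poly (pderiv Q) d = 0" for d
    unfolding D_def using finD by (auto simp: poly_prod)
  have hf: "f holomorphic_on UNIV" and trans: "\<not> (\<exists>p. \<forall>z. f z = poly p z)"
    using assms(12) by (auto simp: transcendental_entire_def)
  have fnc: "\<not> (\<exists>b. \<forall>z. f z = b)"
  proof
    assume "\<exists>b. \<forall>z. f z = b"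
    then obtain b where "\<And>z. f z = poly [:b:] z" by auto
    then show False using trans by blast
  qed
  have hg: "g holomorphic_on UNIV" unfolding g_def by (rule holomorphic_translate[OF hf])
  have gnc: "\<not> (\<exists>b. \<forall>z. g z = b)"
  proof
    assume "\<exists>b. \<forall>z. g z = b"
    then obtain b where "\<And>z. g z = b" by blast
    then have "f z = b" for z by (metis g_def diff_add_cancel)
    then show False using fnc by blast
  qed
  interpret shared_zeros S D f g
  proof
    show "poly D d = 0" if "poly (pderiv (\<Prod>a\<in>S. [:-a, 1:])) d = 0" for d
      using that rootD by (simp add: QS)
    show "2 * degree D + 2 < card S" using assms(9) degD cardS by simp
    show "share_set_weight f g S 2" using assms(15) by (simp add: g_def)
  qed (use finS hf fnc hg gnc in auto)
  have Qeq: "shared_zeros.Q S = Q" using QS by (simp add: Q_def)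
  have no_H: "H z = 0" if z: "F z \<noteq> 0" "G z \<noteq> 0" "deriv F z \<noteq> 0" "deriv G z \<noteq> 0" for z
  proof (rule ccontr)
    assume H: "H z \<noteq> 0"
    obtain b where b: "b \<ge> 1" "\<And>z. cmod (f z) \<le> exp (exp (b * (cmod z + 1)))"
      by (rule hyper_order_growth[OF hf assms(13)]) (rule that)
    \<comment> \<open>One constant has to serve both functions in the growth argument. For
      \<open>f\<close> itself the enlarged bound is read off as a translation by 0.\<close>
    define b' where "b' = b * (1 + cmod c)"
    have "b * 1 \<le> b'" unfolding b'_def using b(1) by (intro mult_left_mono) auto
    then have b': "1 \<le> b'" "b * (1 + cmod 0) \<le> b'" using b(1) by auto
    have gf: "cmod (f z) \<le> exp (exp (b' * (cmod z + 1)))" for z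
      using double_exp_growth_shift[OF b b'(2), of z] by simp
    have gg: "cmod (g z) \<le> exp (exp (b' * (cmod z + 1)))" for z
      unfolding g_def by (rule double_exp_growth_shift[OF b]) (simp add: b'_def)
    have "poly D (f z) \<noteq> 0" "poly D (g z) \<noteq> 0"
      using z(3,4) deriv_poly_compose[OF hf, of Q] deriv_poly_compose[OF hg, of Q] rootD
      by (auto simp: F_def G_def Qeq)
    then have "\<exists>p. \<forall>z. f z = poly p z" by (rule polynomial_if_H_nonzero[OF b'(1) gf gg z H])
    then show False using trans by blast
  qed
  obtain A B where A: "A \<noteq> 0" and AB: "\<And>z. G z = A * F z + B * F z * G z"
    using Moebius_relation_if_H_zero no_H by blast
  have "B = 0"
  proof (rule ccontr)
    assume B: "B \<noteq> 0"
    \<comment> \<open>Inserting F = 1/B into G = A F + B F G leaves A/B = 0.\<close>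
    have omit: "poly Q (f z) \<noteq> 1 / B" for z
    proof
      assume "poly Q (f z) = 1 / B"
      then have "F z = 1 / B" by (simp add: F_def Qeq)
      then show False using AB[of z] A B by simp
    qed
    have "x = y" if "poly Q x = 1 / B" "poly Q y = 1 / B" for x y
    proof (rule ccontr)
      assume "x \<noteq> y"
      moreover have "range f \<inter> {x, y} = {}" using omit that by auto
      ultimately obtain b where "f = (\<lambda>x. b)" using little_Picard[OF hf] by blast
      then show False using fnc by auto
    qed
    then have "k \<le> 1" unfolding assms(8) by (intro poly_shift_one_root) (use degree_Q assms(1) in auto)
    then show False using assms(11) by simp
  qed
  then have "poly Q (g z) = A * poly Q (f z)" for z
    using AB[of z] by (simp add: F_def G_def Qeq)
  then have "\<forall>\<^sub>\<approx>z. poly Q (g z) = A * poly Q (f z)" by simp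
  then have "\<forall>\<^sub>\<approx>z. g z = f z"
    using assms(4) nonconstant_mero_entire[OF hf fnc] nonconstant_mero_entire[OF hg gnc] A
    unfolding strong_uniqueness_poly_def by blast
  then show ?thesis using cosparse_eq_imp_eq_entire[OF hg hf] by (metis g_def)
qed

end
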